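(* Let $V$ be an infinite-dimensional vector space over a field $\mathbb{F}$ of characteristic $2$, and let $u\in\mathrm{End}(V)$. Then $u$ is the sum of three idempotent endomorphisms of $V$ if and only if none of the following conditions holds: (i) $u$ has a dominant eigenvalue outside of $\{0_{\mathbb{F}},1_{\mathbb{F}}\}$; (ii) there exists $\lambda\in\{0_{\mathbb{F}},1_{\mathbb{F}}\}$ such that $u-\lambda\,\mathrm{id}_V$ has finite rank and trace outside of $\{0_{\mathbb{F}},1_{\mathbb{F}}\}$.
   Context: A scalar $\lambda$ is a dominant eigenvalue of $u\in\mathrm{End}(V)$ if $\operatorname{rk}(u-\lambda\,\mathrm{id}_V)<\dim V$. An endomorphism $e$ is idempotent if $e^2=e$. *)

theory Defs
  imports Complex_Main
begin

text \<open>Vector spaces are given by a scalar multiplication scale :: 'f => 'v => 'v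
  satisfying the library locale vector_space scale.\<close>

definition is_basis_of :: "('f::field \<Rightarrow> 'v::ab_group_add \<Rightarrow> 'v) \<Rightarrow> 'v set \<Rightarrow> 'v set \<Rightarrow> bool" where
  "is_basis_of scale B S \<longleftrightarrow>
     B \<subseteq> S \<and> \<not> module.dependent scale B \<and> module.span scale B = module.span scale S"

definition dimc :: "('f::field \<Rightarrow> 'v::ab_group_add \<Rightarrow> 'v) \<Rightarrow> 'v set \<Rightarrow> 'v rel" where
  "dimc scale S = card_of (SOME B. is_basis_of scale B S)"

definition rk :: "('f::field \<Rightarrow> 'v::ab_group_add \<Rightarrow> 'v) \<Rightarrow> ('v \<Rightarrow> 'v) \<Rightarrow> 'v rel" where
  "rk scale w = dimc scale (range w)"

definition infinite_dimensional :: "('f::field \<Rightarrow> 'v::ab_group_add \<Rightarrow> 'v) \<Rightarrow> bool" where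
  "infinite_dimensional scale \<longleftrightarrow> \<not> (\<exists>B. finite B \<and> module.span scale B = UNIV)"

definition dominant_eigenvalue :: "('f::field \<Rightarrow> 'v::ab_group_add \<Rightarrow> 'v) \<Rightarrow> ('v \<Rightarrow> 'v) \<Rightarrow> 'f \<Rightarrow> bool" where
  "dominant_eigenvalue scale u c \<longleftrightarrow> (rk scale (\<lambda>x. u x - scale c x), dimc scale UNIV) \<in> ordLess"

definition finite_rank :: "('f::field \<Rightarrow> 'v::ab_group_add \<Rightarrow> 'v) \<Rightarrow> ('v \<Rightarrow> 'v) \<Rightarrow> bool" where
  "finite_rank scale w \<longleftrightarrow> (\<exists>B. finite B \<and> module.span scale B = range w)"

text \<open>Trace of a finite-rank endomorphism w: trace of its restriction to the
  (finite-dimensional, w-invariant) subspace range w, computed in a basis of range w.\<close>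
definition fr_trace :: "('f::field \<Rightarrow> 'v::ab_group_add \<Rightarrow> 'v) \<Rightarrow> ('v \<Rightarrow> 'v) \<Rightarrow> 'f" where
  "fr_trace scale w =
     (let B = (SOME B. is_basis_of scale B (range w))
      in \<Sum>b\<in>B. module.representation scale B (w b) b)"

definition idempotent_endo :: "('f::field \<Rightarrow> 'v::ab_group_add \<Rightarrow> 'v) \<Rightarrow> ('v \<Rightarrow> 'v) \<Rightarrow> bool" where
  "idempotent_endo scale e \<longleftrightarrow> Vector_Spaces.linear scale scale e \<and> e \<circ> e = e"

end

theory Submission
  imports Defs
begin

text \<open>
  In characteristic 2 an endomorphism whose two diagonal blocks along a decomposition \<open>V = X \<oplus> Y\<close> vanish
  is a sum of two idempotents, and for every \<open>P\<close> and every isomorphism \<open>Y \<cong> X\<close> there is an idempotent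
  with diagonal blocks \<open>P\<close> and (a copy of) \<open>1 - P\<close>. So it suffices to choose the decomposition so that
  the diagonal blocks of \<open>u\<close> have this shape, possibly after splitting off a summand that \<open>u\<close> maps
  into \<open>X\<close>. Fixing \<open>X\<close> and an isomorphism \<open>V/X \<cong> X\<close>, this becomes a linear equation for the projection
  onto \<open>X\<close>. Given chains \<open>s\<^sub>n\<close>, \<open>y\<^sub>n\<close> with \<open>u s\<^sub>n = c y\<^sub>n + y\<^sub>n\<^sub>+\<^sub>1\<close>, the equation is a recursion for the image of
  \<open>y\<^sub>n\<close>. It is always solvable on infinite chains, which exist when \<open>u\<close> has infinite rank and is not
  closer to a scalar than to \<open>0\<close>. For finite rank one uses a single finite chain, taken from a
  Hessenberg basis of the range of \<open>u\<close>; the recursion has to end in \<open>0\<close>, which is a condition on the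
  diagonal (the trace, settled by the choice of \<open>c \<in> {0, 1}\<close>) and on the subdiagonal (a parity,
  settled by dropping the first basis vector).

  Conversely, if \<open>A + B + E = c + w\<close> with idempotents \<open>A\<close>, \<open>B\<close>, \<open>E\<close>, then the smallest subspace that
  contains the range of \<open>w\<close> and is stable under the idempotents is no larger than four copies of that
  range. The scalar \<open>c\<^sup>2 + c\<close> vanishes on the quotient by it, and if it is finite-dimensional then the
  trace of \<open>w\<close> is a sum of traces of idempotents on it and of copies of \<open>c\<close>.
\<close>

section \<open>Compressions and chains\<close>

locale char2_space = vector_space scale
  for scale :: "'f::field \<Rightarrow> 'v::ab_group_add \<Rightarrow> 'v" (infixr \<open>*s\<close> 75) +
  assumes char2: "(1::'f) + 1 = 0"
begin

sublocale pair: vector_space_pair scale scale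
  by unfold_locales

abbreviation lin :: "('v \<Rightarrow> 'v) \<Rightarrow> bool" where
  "lin f \<equiv> Vector_Spaces.linear scale scale f"

lemmas lin_simps = pair.linear_add pair.linear_diff pair.linear_scale pair.linear_0 pair.linear_sum

lemma linI:
  assumes "\<And>x y. f (x + y) = f x + f y" and "\<And>c x. f (c *s x) = c *s f x"
  shows "lin f"
  by (simp add: Vector_Spaces.linear_iff vector_space_axioms assms)

lemma vec_double [simp]: "(x::'v) + x = 0"
  by (metis char2 scale_left_distrib scale_one scale_zero_left)

lemma vec_double' [simp]: "(x::'v) + (x + y) = y"
  by (simp flip: add.assoc)

lemma vec_diff: "(x::'v) - y = x + y"
  by (metis add_diff_cancel vec_double' add.commute)

lemma vec_eq_iff: "(x::'v) = y \<longleftrightarrow> x + y = 0"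
  by (metis right_minus_eq vec_diff)

section \<open>From a block decomposition to three idempotents\<close>

definition three_idempotents :: "('v \<Rightarrow> 'v) \<Rightarrow> bool" where
  "three_idempotents u \<longleftrightarrow>
    (\<exists>e1 e2 e3. idempotent_endo scale e1 \<and> idempotent_endo scale e2 \<and> idempotent_endo scale e3
      \<and> u = (\<lambda>x. e1 x + e2 x + e3 x))"

text \<open>Let \<open>X\<close> be the range of \<open>\<pi>\<close> and \<open>P\<close> the
  compression of \<open>u\<close> to \<open>X\<close>. By \<open>comp\<close>, the block of
  \<open>u\<close> on the kernel of \<open>\<pi>\<close> is \<open>1 - P\<close>, transported by
  \<open>g\<close> and \<open>j\<close>. One idempotent carries both diagonal blocks; the
  off-diagonal rest is a sum of two. As \<open>g\<close> may vanish on part of the kernel, a summand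
  that \<open>u\<close> maps into \<open>X\<close> is allowed.\<close>

lemma three_idempotents_of_compression:
  assumes lin: "lin u" "lin \<pi>" "lin g" "lin j"
    and pp: "\<And>v. \<pi> (\<pi> v) = \<pi> v" and pg: "\<And>v. \<pi> (g v) = g v"
    and gp: "\<And>v. g (\<pi> v) = 0" and pj: "\<And>v. \<pi> (j v) = 0"
    and gj: "\<And>v. \<pi> v = v \<Longrightarrow> g (j v) = v"
    and comp: "\<And>v. u (v - \<pi> v) - \<pi> (u (v - \<pi> v)) = j (g v - \<pi> (u (g v)))"
  shows "three_idempotents u"
proof -
  note L = lin_simps[OF lin(1)] lin_simps[OF lin(2)] lin_simps[OF lin(3)] lin_simps[OF lin(4)]
  \<comment> \<open>\<open>e\<close> factors through \<open>X\<close>: first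
    \<open>\<pi> v + g v\<close>, then the map taking \<open>x\<close> to
    \<open>P x + j (x + P x)\<close>. Composed in the other order these give
    \<open>P x + (x + P x) = x\<close>, which is \<open>te\<close> and makes \<open>e\<close>
    idempotent.\<close>
  define e where "e v = \<pi> (u (\<pi> v + g v)) + j (\<pi> v + g v + \<pi> (u (\<pi> v + g v)))" for v
  define r where "r v = u v + e v" for v
  \<comment> \<open>\<open>r\<close> exchanges the range and the kernel of \<open>\<pi>\<close>
    (\<open>prp\<close>, \<open>qrq\<close>). \<open>f\<close> is a projection onto the range,
    \<open>h\<close> one with the same kernel as \<open>\<pi>\<close>; together they contain
    \<open>\<pi>\<close> twice, which cancels.\<close>
  define f where "f v = \<pi> v + \<pi> (r (v + \<pi> v))" for v
  define h where "h v = \<pi> v + (r (\<pi> v) + \<pi> (r (\<pi> v)))" for v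
  have le: "lin e"
    by (intro linI) (simp_all add: e_def L scale_right_distrib ac_simps)
  note Le = lin_simps[OF le]
  have lr: "lin r"
    by (intro linI) (simp_all add: r_def L Le scale_right_distrib ac_simps)
  note Lr = lin_simps[OF lr]
  have lf: "lin f" and lh: "lin h"
    by (intro linI; simp add: f_def h_def L Lr scale_right_distrib ac_simps)+
  have te: "\<pi> (e v) + g (e v) = \<pi> v + g v" for v
  proof -
    define t where "t = \<pi> v + g v"
    have "\<pi> t = t" by (simp add: t_def L pp pg)
    have "g (j (t + \<pi> (u t))) = t + \<pi> (u t)"
      by (rule gj) (simp add: L pp \<open>\<pi> t = t\<close>)
    then show ?thesis
      unfolding e_def t_def[symmetric] by (simp add: L pp pj gp ac_simps)
  qed
  have ee: "e (e v) = e v" for v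
    using te[of v] by (simp add: e_def)
  have prp: "\<pi> (r (\<pi> v)) = 0" for v
    by (simp add: r_def e_def L pp gp pj)
  have qrq: "r (v + \<pi> v) = \<pi> (r (v + \<pi> v))" for v
  proof -
    have "e (v + \<pi> v) + \<pi> (e (v + \<pi> v)) = j (g v + \<pi> (u (g v)))"
      by (simp add: e_def L pp gp pj ac_simps)
    moreover have "u (v + \<pi> v) + \<pi> (u (v + \<pi> v)) = j (g v + \<pi> (u (g v)))"
      using comp[of v] by (simp add: vec_diff)
    ultimately have "e (v + \<pi> v) + \<pi> (e (v + \<pi> v)) + (u (v + \<pi> v) + \<pi> (u (v + \<pi> v))) = 0"
      by simp
    then show ?thesis
      by (subst vec_eq_iff) (simp add: r_def L ac_simps)
  qed
  have pf: "\<pi> (f v) = f v" for v by (simp add: f_def L pp)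
  have ff: "f (f v) = f v" for v
    by (subst f_def) (simp add: pf L Lr)
  have ph: "\<pi> (h v) = \<pi> v" for v by (simp add: h_def L pp)
  have hh: "h (h v) = h v" for v
    by (subst (1 3) h_def) (simp add: ph)
  have sum: "u v = e v + f v + h v" for v
  proof -
    have "r v = r (v + \<pi> v) + r (\<pi> v)" by (simp add: Lr ac_simps)
    also have "\<dots> = f v + h v"
      using qrq[of v] prp[of v] by (simp add: f_def h_def ac_simps)
    finally show ?thesis unfolding r_def by (metis add.assoc add.commute vec_double')
  qed
  show ?thesis
    unfolding three_idempotents_def idempotent_endo_def
    using le lf lh ee ff hh sum by (intro exI[of _ e] exI[of _ f] exI[of _ h]) (auto simp: fun_eq_iff)
qed

text \<open>\<open>X\<close> is the span of the \<open>s k\<close>. The values of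
  \<open>\<pi>\<close> on the \<open>y k\<close> are free, and \<open>g\<close> identifies
  \<open>y k\<close> with \<open>s k\<close> modulo \<open>X\<close>. Tested on the
  \<open>y k\<close>, the compression condition becomes \<open>eq\<close>, which is linear in these
  values; on the \<open>s k\<close> and on \<open>Z\<close> both sides vanish.\<close>

lemma three_idempotents_of_basis:
  fixes s y :: "'k \<Rightarrow> 'v"
  assumes u: "lin u"
    and inj: "inj_on s K" "inj_on y K"
    and disj: "s ` K \<inter> y ` K = {}" "(s ` K \<union> y ` K) \<inter> Z = {}"
    and indep: "independent (s ` K \<union> y ` K \<union> Z)"
    and span: "span (s ` K \<union> y ` K \<union> Z) = UNIV"
    and us: "\<And>k. k \<in> K \<Longrightarrow> u (s k) \<in> span (y ` K)"
    and uy: "\<And>k. k \<in> K \<Longrightarrow> u (y k) \<in> span (s ` K \<union> y ` K)"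
    and uz: "\<And>z. z \<in> Z \<Longrightarrow> u z \<in> span (s ` K)"
    and lin: "lin \<pi>" "lin g"
    and ps: "\<And>k. k \<in> K \<Longrightarrow> \<pi> (s k) = s k" and gs: "\<And>k. k \<in> K \<Longrightarrow> g (s k) = 0"
    and py: "\<And>k. k \<in> K \<Longrightarrow> \<pi> (y k) \<in> span (s ` K)" and gy: "\<And>k. k \<in> K \<Longrightarrow> g (y k) = s k"
    and pz: "\<And>z. z \<in> Z \<Longrightarrow> \<pi> z = 0" and gz: "\<And>z. z \<in> Z \<Longrightarrow> g z = 0"
    and eq: "\<And>k. k \<in> K \<Longrightarrow> \<pi> (u (s k)) = s k + g (u (y k)) + g (u (\<pi> (y k)))"
  shows "three_idempotents u"
proof -
  let ?B = "s ` K \<union> y ` K \<union> Z"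
  \<comment> \<open>\<open>j\<close> has to land in the kernel of \<open>\<pi>\<close>, so
    \<open>s k\<close> goes to \<open>y k\<close> corrected by its own projection.\<close>
  obtain j where lj: "lin j" and jB: "\<And>b. b \<in> ?B \<Longrightarrow>
      j b = (if b \<in> s ` K then y (the_inv_into K s b) + \<pi> (y (the_inv_into K s b)) else 0)"
    using pair.linear_independent_extend[OF indep,
        of "\<lambda>b. if b \<in> s ` K then y (the_inv_into K s b) + \<pi> (y (the_inv_into K s b)) else 0"]
    by blast
  have js: "j (s k) = y k + \<pi> (y k)" if "k \<in> K" for k
    using jB[of "s k"] that by (simp add: the_inv_into_f_f inj)
  have jy: "j (y k) = 0" if "k \<in> K" for k
    using jB[of "y k"] that disj by (simp, blast)
  have jz: "j z = 0" if "z \<in> Z" for z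
    using jB[of z] that disj by (simp, blast)
  note L = lin_simps[OF u] lin_simps[OF lin(1)] lin_simps[OF lin(2)] lin_simps[OF lj]
  have l1: "lin (\<lambda>v. f v + h v)" "lin (\<lambda>v. f (h v))" if "lin f" "lin h" for f h
    by (intro linI; simp add: lin_simps[OF that(1)] lin_simps[OF that(2)] scale_right_distrib ac_simps)+
  have l0: "lin (\<lambda>v. 0)" "lin (\<lambda>v. v)" by (simp_all add: linI)
  have ext: "f v = h v" if "lin f" "lin h" "\<And>k. k \<in> K \<Longrightarrow> f (s k) = h (s k)"
      "\<And>k. k \<in> K \<Longrightarrow> f (y k) = h (y k)" "\<And>z. z \<in> Z \<Longrightarrow> f z = h z" for f h v
    by (rule pair.linear_eq_on[of f h v ?B]) (use that span in auto)
  have pX: "\<pi> v = v" and gX: "g v = 0" if "v \<in> span (s ` K)" for v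
    using pair.linear_eq_on[of \<pi> "\<lambda>v. v" v "s ` K"] pair.linear_eq_on[of g "\<lambda>v. 0" v "s ` K"]
      lin l0 ps gs that by auto
  have pin: "\<pi> v \<in> span (s ` K)" for v
  proof -
    have "v \<in> span ?B" using span by simp
    then show ?thesis
      by (induction rule: span_induct_alt)
        (auto simp: L span_zero ps pz py intro!: span_add span_scale intro: span_base)
  qed
  have gin: "g v \<in> span (s ` K)" for v
  proof -
    have "v \<in> span ?B" using span by simp
    then show ?thesis
      by (induction rule: span_induct_alt)
        (auto simp: L span_zero gs gz gy intro!: span_add span_scale intro: span_base)
  qed
  have pj: "\<pi> (j v) = 0" for v
    by (rule ext[OF l1(2)[OF lin(1) lj] l0(1)]) (simp_all add: js jy jz L pX[OF pin])
  have gj: "g (j v) = \<pi> v" if "\<pi> v = v" for v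
  proof -
    have "v \<in> span (s ` K)" using that pin by metis
    then have "g (j v) = v"
      by (rule pair.linear_eq_on[OF l1(2)[OF lin(2) lj] l0(2)]) (auto simp: js L gy gX[OF pin])
    then show ?thesis using that by simp
  qed
  have jg: "w + \<pi> w = j (g w)" if "w \<in> span (s ` K \<union> y ` K)" for w
    by (rule pair.linear_eq_on[OF l1(1)[OF l0(2) lin(1)] l1(2)[OF lj lin(2)] that])
      (auto simp: ps gs gy js L)
  have uX: "u v \<in> span (y ` K)" if "v \<in> span (s ` K)" for v
    using that by (induction rule: span_induct_alt) (auto simp: L span_zero us intro!: span_add span_scale)
  have comp: "u (v + \<pi> v) + \<pi> (u (v + \<pi> v)) = j (g v + \<pi> (u (g v)))" for v
  proof (rule ext[where f = "\<lambda>v. u (v + \<pi> v) + \<pi> (u (v + \<pi> v))" and h = "\<lambda>v. j (g v + \<pi> (u (g v)))"])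
    show "lin (\<lambda>v. u (v + \<pi> v) + \<pi> (u (v + \<pi> v)))" "lin (\<lambda>v. j (g v + \<pi> (u (g v))))"
      using l1(1)[OF l1(2)[OF u l1(1)[OF l0(2) lin(1)]] l1(2)[OF lin(1) l1(2)[OF u l1(1)[OF l0(2) lin(1)]]]]
        l1(2)[OF lj l1(1)[OF lin(2) l1(2)[OF lin(1) l1(2)[OF u lin(2)]]]] by simp_all
  next
    fix k assume k: "k \<in> K"
    show "u (s k + \<pi> (s k)) + \<pi> (u (s k + \<pi> (s k))) = j (g (s k) + \<pi> (u (g (s k))))"
      using k by (simp add: ps gs L)
    have "u (\<pi> (y k)) \<in> span (s ` K \<union> y ` K)"
      using uX[OF pin] span_mono[of "y ` K" "s ` K \<union> y ` K"] by auto
    then have "u (y k + \<pi> (y k)) \<in> span (s ` K \<union> y ` K)"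
      using uy[OF k] by (simp add: L span_add)
    from jg[OF this] show "u (y k + \<pi> (y k)) + \<pi> (u (y k + \<pi> (y k))) = j (g (y k) + \<pi> (u (g (y k))))"
      using k eq by (simp add: gy L ac_simps)
  next
    fix z assume "z \<in> Z"
    then show "u (z + \<pi> z) + \<pi> (u (z + \<pi> z)) = j (g z + \<pi> (u (g z)))"
      using pX[OF uz] by (simp add: pz gz L)
  qed
  show ?thesis
  proof (rule three_idempotents_of_compression[OF u lin lj])
    show "\<pi> (\<pi> v) = \<pi> v" "\<pi> (g v) = g v" "g (\<pi> v) = 0" for v
      by (simp_all add: pX gX pin gin)
  qed (use pj gj comp in \<open>auto simp: vec_diff\<close>)
qed


section \<open>Solving for the projection along chains\<close>

lemma lin_range:
  assumes f: "lin f" and "span B = UNIV" and B: "\<And>b. b \<in> B \<Longrightarrow> f b \<in> span A"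
  shows "f v \<in> span A"
proof -
  have "v \<in> span B" using assms by simp
  then show ?thesis
    by (induction rule: span_induct_alt) (auto simp: lin_simps[OF f] span_zero B intro!: span_add span_scale)
qed

lemma linear_extension:
  assumes "inj_on s K" "inj_on y K" "s ` K \<inter> y ` K = {}" "(s ` K \<union> y ` K) \<inter> Z = {}"
    and indep: "independent (s ` K \<union> y ` K \<union> Z)"
  obtains f where "lin f" "\<And>k. k \<in> K \<Longrightarrow> f (s k) = a k" "\<And>k. k \<in> K \<Longrightarrow> f (y k) = b k"
    "\<And>z. z \<in> Z \<Longrightarrow> f z = 0"
proof -
  let ?f = "\<lambda>v. if v \<in> s ` K then a (the_inv_into K s v)
    else if v \<in> y ` K then b (the_inv_into K y v) else 0"
  obtain f where f: "lin f" and "\<And>v. v \<in> s ` K \<union> y ` K \<union> Z \<Longrightarrow> f v = ?f v"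
    using pair.linear_independent_extend[OF indep, of ?f] by blast
  note this(2)[simp]
  have "f (s k) = a k" "f (y k) = b k" if "k \<in> K" for k
    using that assms by (simp_all add: the_inv_into_f_f disjoint_iff) force+
  moreover have "f z = 0" if "z \<in> Z" for z
    using that assms by (auto simp: disjoint_iff)
  ultimately show thesis using f that by blast
qed

text \<open>Here \<open>p k\<close> is the value of the projection at \<open>y k\<close>. As
  \<open>u (s k)\<close> involves only \<open>y k\<close> and its successor, \<open>eq\<close>
  computes \<open>p (nx k)\<close> from \<open>p k\<close>. Where a chain stops, the computed value
  has to be 0.\<close>

lemma three_idempotents_of_chain:
  fixes s y p :: "'k \<Rightarrow> 'v"
  assumes u: "lin u"
    and inj: "inj_on s K" "inj_on y K"
    and disj: "s ` K \<inter> y ` K = {}" "(s ` K \<union> y ` K) \<inter> Z = {}"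
    and indep: "independent (s ` K \<union> y ` K \<union> Z)"
    and span: "span (s ` K \<union> y ` K \<union> Z) = UNIV"
    and us: "\<And>k. k \<in> K \<Longrightarrow> u (s k) = c *s y k + (if nx k \<in> K then y (nx k) else 0)"
    and uy: "\<And>k. k \<in> K \<Longrightarrow> u (y k) \<in> span (s ` K \<union> y ` K)"
    and uz: "\<And>z. z \<in> Z \<Longrightarrow> u z \<in> span (s ` K)"
    and g: "lin g" and gs: "\<And>k. k \<in> K \<Longrightarrow> g (s k) = 0"
    and gy: "\<And>k. k \<in> K \<Longrightarrow> g (y k) = s k" and gz: "\<And>z. z \<in> Z \<Longrightarrow> g z = 0"
    and p: "\<And>k. k \<in> K \<Longrightarrow> p k \<in> span (s ` K)"
    and step: "\<And>k. k \<in> K \<Longrightarrow>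
      s k + g (u (y k)) + (g (u (p k)) + c *s p k) = (if nx k \<in> K then p (nx k) else 0)"
  shows "three_idempotents u"
proof -
  obtain \<pi> where \<pi>: "lin \<pi>" "\<And>k. k \<in> K \<Longrightarrow> \<pi> (s k) = s k" "\<And>k. k \<in> K \<Longrightarrow> \<pi> (y k) = p k"
      "\<And>z. z \<in> Z \<Longrightarrow> \<pi> z = 0"
    using linear_extension[OF inj disj indep, of s p] by blast
  show ?thesis
  proof (rule three_idempotents_of_basis[OF u inj disj indep span])
    fix k assume k: "k \<in> K"
    show "u (s k) \<in> span (y ` K)"
      using k by (auto simp: us intro!: span_add span_scale span_zero intro: span_base)
    have "\<pi> (u (s k)) = c *s p k + (if nx k \<in> K then p (nx k) else 0)"
      using k by (simp add: us lin_simps[OF \<pi>(1)] \<pi>)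
    also have "\<dots> = s k + g (u (y k)) + g (u (p k))"
      unfolding step[OF k, symmetric] by (simp add: ac_simps)
    finally show "\<pi> (u (s k)) = s k + g (u (y k)) + g (u (\<pi> (y k)))"
      using k by (simp add: \<pi>)
  qed (use \<pi> uy uz g gs gy gz p in auto)
qed

text \<open>A chain without last element has no closing condition, so the recursion started at 0
  always yields a projection. The coefficient \<open>c\<close> is 0 here.\<close>

lemma three_idempotents_of_infinite_chains:
  fixes s y :: "'i \<times> nat \<Rightarrow> 'v" and I :: "'i set"
  defines "K \<equiv> I \<times> UNIV"
  assumes u: "lin u"
    and inj: "inj_on s K" "inj_on y K"
    and disj: "s ` K \<inter> y ` K = {}" "(s ` K \<union> y ` K) \<inter> Z = {}"
    and indep: "independent (s ` K \<union> y ` K \<union> Z)"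
    and span: "span (s ` K \<union> y ` K \<union> Z) = UNIV"
    and us: "\<And>i n. i \<in> I \<Longrightarrow> u (s (i, n)) = y (i, Suc n)"
    and uy: "\<And>k. k \<in> K \<Longrightarrow> u (y k) \<in> span (s ` K \<union> y ` K)"
    and uz: "\<And>z. z \<in> Z \<Longrightarrow> u z = 0"
  shows "three_idempotents u"
proof -
  obtain g where g: "lin g" "\<And>k. k \<in> K \<Longrightarrow> g (s k) = 0" "\<And>k. k \<in> K \<Longrightarrow> g (y k) = s k"
      "\<And>z. z \<in> Z \<Longrightarrow> g z = 0"
    using linear_extension[OF inj disj indep, of "\<lambda>_. 0" s] by blast
  have gin: "g v \<in> span (s ` K)" for v
    by (rule lin_range[OF g(1) span]) (auto simp: g span_zero intro: span_base)
  define P where "P i = rec_nat 0 (\<lambda>n q. s (i, n) + g (u (y (i, n))) + g (u q))" for i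
  have "P i n \<in> span (s ` K)" if "i \<in> I" for i n
    using that by (induction n) (auto simp: P_def K_def span_zero intro!: span_add gin[unfolded K_def] span_base[OF imageI])
  then show ?thesis
    using g us uy uz
    by (intro three_idempotents_of_chain[OF u inj disj indep span, of 0 "\<lambda>(i, n). (i, Suc n)" g
          "\<lambda>(i, n). P i n"])
      (auto simp: K_def P_def span_zero)
qed

text \<open>The recursion must return to 0 after \<open>N\<close> steps. Since
  \<open>u (y n)\<close> reaches back no further than \<open>y (n - 1)\<close>, two leading
  coefficients of \<open>p n\<close> decide: they accumulate the sums of
  \<open>1 + \<alpha> n\<close> and of \<open>\<beta> n\<close>, and at \<open>n = N\<close> nothing
  else is left.\<close>

lemma three_idempotents_of_finite_chain:
  fixes s y :: "nat \<Rightarrow> 'v" and N :: nat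
  defines "K \<equiv> {..<N}"
  assumes u: "lin u"
    and inj: "inj_on s K" "inj_on y K"
    and disj: "s ` K \<inter> y ` K = {}" "(s ` K \<union> y ` K) \<inter> Z = {}"
    and indep: "independent (s ` K \<union> y ` K \<union> Z)"
    and span: "span (s ` K \<union> y ` K \<union> Z) = UNIV"
    and us: "\<And>n. n < N \<Longrightarrow> u (s n) = c *s y n + (if Suc n < N then y (Suc n) else 0)"
    and uy: "\<And>n. n < N \<Longrightarrow>
      u (y n) + (\<alpha> n *s y n + \<beta> n *s y (n - 1)) \<in> span (s ` K \<union> y ` {Suc n..<N})"
    and \<beta>0: "\<beta> 0 = 0"
    and uz: "\<And>z. z \<in> Z \<Longrightarrow> u z \<in> span (s ` K)"
    and \<alpha>: "(\<Sum>n<N. 1 + \<alpha> n) = 0" and \<beta>: "(\<Sum>n<N. \<beta> n) = 0"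
  shows "three_idempotents u"
proof -
  obtain g where g: "lin g" "\<And>k. k \<in> K \<Longrightarrow> g (s k) = 0" "\<And>k. k \<in> K \<Longrightarrow> g (y k) = s k"
      "\<And>z. z \<in> Z \<Longrightarrow> g z = 0"
    using linear_extension[OF inj disj indep, of "\<lambda>_. 0" s] by blast
  note L = lin_simps[OF u] lin_simps[OF g(1)]
  have gin: "g v \<in> span (s ` K)" for v
    by (rule lin_range[OF g(1) span]) (auto simp: g span_zero intro: span_base)
  \<comment> \<open>The two terms \<open>c *s s n\<close> cancel, so \<open>h\<close> is the plain
    shift along the \<open>s n\<close>, whatever \<open>c\<close> is.\<close>
  define h where "h v = g (u v) + c *s v" for v
  have h: "lin h" by (intro linI) (simp_all add: h_def L scale_right_distrib ac_simps)
  have hs: "h (s n) = (if Suc n < N then s (Suc n) else 0)" if "n < N" for n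
    using that g(3)[of n] g(3)[of "Suc n"] by (simp add: h_def us L K_def ac_simps)
  have hspan: "h x \<in> span (s ` {Suc n..<N})" if "x \<in> span (s ` {n..<N})" for x n
    using that
    by (induction rule: span_induct_alt)
      (auto simp: lin_simps[OF h] span_zero hs intro!: span_add span_scale span_base[OF imageI])
  define p where "p = rec_nat 0 (\<lambda>n q. s n + g (u (y n)) + h q)"
  have p0: "p 0 = 0" and pS: "p (Suc n) = s n + g (u (y n)) + h (p n)" for n
    by (simp_all add: p_def)
  have pin: "p n \<in> span (s ` K)" if "n \<le> N" for n
    using that
    by (induction n) (auto simp: p0 pS h_def K_def span_zero intro!: span_add gin[unfolded K_def] span_scale intro: span_base)
  have gu: "\<exists>x\<in>span (s ` {Suc n..<N}). g (u (y n)) = \<alpha> n *s s n + \<beta> n *s s (n - 1) + x" if n: "n < N" for n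
  proof -
    define w where "w = u (y n) + (\<alpha> n *s y n + \<beta> n *s y (n - 1))"
    have "w \<in> span (s ` K \<union> y ` {Suc n..<N})" using uy[OF n] by (simp add: w_def)
    then have "g w \<in> span (s ` {Suc n..<N})"
      by (induction rule: span_induct_alt)
        (auto simp: L K_def g(2,3)[unfolded K_def] span_zero intro!: span_add span_scale intro: span_base)
    moreover have "g (u (y n)) = \<alpha> n *s s n + \<beta> n *s s (n - 1) + g w"
      using n g(3)[of n] g(3)[of "n - 1"] by (simp add: w_def L K_def ac_simps)
    ultimately show ?thesis by blast
  qed
  \<comment> \<open>Each step shifts both coefficients by one index and adds the contribution of
    \<open>y n\<close>. Where the subtractions truncate, the coefficients concerned are 0; for
    \<open>n = 1\<close> this uses \<open>\<beta> 0 = 0\<close>.\<close>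
  have inv: "\<exists>x\<in>span (s ` {n..<N}). p n = (\<Sum>i<n. 1 + \<alpha> i) *s s (n - 1) + (\<Sum>i<n. \<beta> i) *s s (n - 2) + x"
    if "n \<le> N" for n
    using that
  proof (induction n)
    case 0
    then show ?case by (simp add: p0 span_zero)
  next
    case (Suc n)
    then obtain x where x: "x \<in> span (s ` {n..<N})"
      and pn: "p n = (\<Sum>i<n. 1 + \<alpha> i) *s s (n - 1) + (\<Sum>i<n. \<beta> i) *s s (n - 2) + x"
      by auto
    obtain x' where x': "x' \<in> span (s ` {Suc n..<N})"
      and gun: "g (u (y n)) = \<alpha> n *s s n + \<beta> n *s s (n - 1) + x'"
      using gu[of n] Suc by auto
    have 1: "h ((\<Sum>i<n. 1 + \<alpha> i) *s s (n - 1)) = (\<Sum>i<n. 1 + \<alpha> i) *s s n"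
      using hs[of "n - 1"] Suc by (cases n) (simp_all add: lin_simps[OF h])
    have 2: "h ((\<Sum>i<n. \<beta> i) *s s (n - 2)) = (\<Sum>i<n. \<beta> i) *s s (n - 1)"
    proof (cases "n \<le> 1")
      case True
      then have "n = 0 \<or> n = 1" by auto
      then have "(\<Sum>i<n. \<beta> i) = 0" by (auto simp: \<beta>0)
      then show ?thesis by (simp add: lin_simps[OF h])
    next
      case False
      then have "Suc (n - 2) = n - 1" by simp
      then show ?thesis using hs[of "n - 2"] Suc by (simp add: lin_simps[OF h])
    qed
    have "p (Suc n) = (\<Sum>i<Suc n. 1 + \<alpha> i) *s s n + (\<Sum>i<Suc n. \<beta> i) *s s (n - 1) + (x' + h x)"
      unfolding pS pn gun pair.linear_add[OF h] 1 2 sum.lessThan_Suc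
      by (simp add: scale_left_distrib ac_simps)
    moreover have "x' + h x \<in> span (s ` {Suc n..<N})"
      using x' hspan[OF x] by (rule span_add)
    ultimately show ?case by auto
  qed
  have "p N = 0"
    using inv[of N] \<alpha> \<beta> by simp
  then have "s n + g (u (y n)) + h (p n) = (if Suc n < N then p (Suc n) else 0)" if "n < N" for n
    using that pS[of n] by (cases "Suc n = N") auto
  moreover have "u (y n) \<in> span (s ` K \<union> y ` K)" if n: "n < N" for n
  proof -
    have "u (y n) + (\<alpha> n *s y n + \<beta> n *s y (n - 1)) \<in> span (s ` K \<union> y ` K)"
      by (rule subsetD[OF span_mono uy[OF n]]) (auto simp: K_def)
    moreover have "\<alpha> n *s y n + \<beta> n *s y (n - 1) \<in> span (s ` K \<union> y ` K)"
      using n by (intro span_add span_scale) (auto simp: K_def intro: span_base)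
    ultimately show ?thesis by (simp add: span_add_eq2)
  qed
  ultimately show ?thesis
    using g us uz pin
    by (intro three_idempotents_of_chain[OF u inj disj indep span, of c Suc g p])
      (auto simp: K_def h_def)
qed

end

section \<open>Finite rank\<close>

context char2_space begin

text \<open>As \<open>u\<close> maps the span of \<open>F\<close> onto its range, that span and the
  kernel generate the whole space, so the missing basis vectors can be taken from the
  kernel.\<close>

lemma complete_by_kernel:
  assumes u: "lin u" and F: "independent F" and r: "range u \<subseteq> span (u ` F)"
  obtains C where "C \<inter> F = {}" "independent (F \<union> C)" "span (F \<union> C) = UNIV" "\<And>z. z \<in> C \<Longrightarrow> u z = 0"
proof -
  obtain B where B: "F \<subseteq> B" "B \<subseteq> F \<union> {v. u v = 0}" "independent B" "F \<union> {v. u v = 0} \<subseteq> span B"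
    using maximal_independent_subset_extend[of F "F \<union> {v. u v = 0}"] F by auto
  have "v \<in> span B" for v
  proof -
    have "u v \<in> u ` span F" using r pair.linear_span_image[OF u] by blast
    then obtain f where f: "f \<in> span F" "u v = u f" by blast
    then have "v - f \<in> span B" using B(4) by (auto simp: lin_simps[OF u])
    moreover have "f \<in> span B" using f(1) B(1) span_mono by blast
    ultimately show ?thesis using span_add by fastforce
  qed
  then have "span B = UNIV" by auto
  moreover have "F \<union> (B - F) = B" using B(1) by auto
  ultimately show thesis using B by (intro that[of "B - F"]) auto
qed

text \<open>A fibre of \<open>u\<close> is a translate of the kernel, which is infinite-dimensional
  because the rank is finite; so no finite set spans a whole fibre.\<close>

lemma fresh_preimage:
  assumes u: "lin u" and inf: "infinite_dimensional scale" and fr: "finite_rank scale u"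
    and F: "finite F" and w: "w \<in> range u"
  obtains v where "u v = w" "v \<notin> span F"
proof (rule ccontr)
  assume "\<not> thesis"
  then have all: "v \<in> span F" if "u v = w" for v using that \<open>\<And>v. \<lbrakk>u v = w; v \<notin> span F\<rbrakk> \<Longrightarrow> thesis\<close> by blast
  obtain v0 where v0: "u v0 = w" using w by auto
  have ker: "k \<in> span F" if "u k = 0" for k
  proof -
    have "v0 + k \<in> span F" using that v0 by (intro all) (simp add: lin_simps[OF u])
    then show ?thesis using all[OF v0] span_add_eq by blast
  qed
  obtain R0 where R0: "finite R0" "span R0 = range u"
    using fr unfolding finite_rank_def by blast
  then have "R0 \<subseteq> range u" using span_superset by blast
  then obtain G where G: "finite G" "R0 = u ` G" using R0(1) by (meson finite_subset_image)
  have "v \<in> span (F \<union> G)" for v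
  proof -
    have "u v \<in> u ` span G" using R0(2) G(2) pair.linear_span_image[OF u] by blast
    then obtain f where f: "f \<in> span G" "u v = u f" by blast
    then have "v - f \<in> span (F \<union> G)"
      using ker[of "v - f"] span_mono[of F "F \<union> G"] by (auto simp: lin_simps[OF u])
    moreover have "f \<in> span (F \<union> G)" using f(1) span_mono[of G "F \<union> G"] by auto
    ultimately show ?thesis using span_add by fastforce
  qed
  then have "span (F \<union> G) = UNIV" by auto
  then show False
    using inf F G(1) unfolding infinite_dimensional_def by blast
qed

lemma fresh_preimages:
  fixes w :: "nat \<Rightarrow> 'v"
  assumes u: "lin u" "infinite_dimensional scale" "finite_rank scale u"
    and F: "finite F" "independent F"
  shows "(\<And>i. i < m \<Longrightarrow> w i \<in> range u) \<Longrightarrow> \<exists>x. (\<forall>i<m. u (x i) = w i) \<and> inj_on x {..<m} \<and> x ` {..<m} \<inter> F = {}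
    \<and> independent (F \<union> x ` {..<m})"
proof (induction m)
  case 0
  then show ?case using F by simp
next
  case (Suc m)
  then obtain x where x: "\<forall>i<m. u (x i) = w i" "inj_on x {..<m}" "x ` {..<m} \<inter> F = {}"
    "independent (F \<union> x ` {..<m})"
    by auto
  obtain v where v: "u v = w m" "v \<notin> span (F \<union> x ` {..<m})"
    using fresh_preimage[OF u, of "F \<union> x ` {..<m}" "w m"] F Suc.prems by blast
  then have v': "v \<notin> F" "v \<notin> x ` {..<m}" by (auto intro: span_base)
  let ?x = "x(m := v)"
  have im: "?x ` {..<Suc m} = insert v (x ` {..<m})"
    by (auto simp: lessThan_Suc)
  have "independent (F \<union> ?x ` {..<Suc m})"
    unfolding im using x(4) v(2) by (simp add: independent_insertI)
  moreover have "inj_on ?x {..<Suc m}"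
    using x(2) v' by (auto simp: inj_on_def less_Suc_eq)
  moreover have "?x ` {..<Suc m} \<inter> F = {}" unfolding im using x(3) v' by auto
  moreover have "\<forall>i<Suc m. u (?x i) = w i" using x(1) v(1) by (auto simp: less_Suc_eq)
  ultimately show ?case by blast
qed

lemma two_eq_0: "(2::'f) = 0"
  using char2 by simp

lemma of_nat_01: "(of_nat n :: 'f) \<in> {0, 1}"
  by (induction n) (auto simp: two_eq_0)

text \<open>In characteristic 2 the set \<open>{0, 1}\<close> is the prime subfield, which is why
  the trace conditions can be added up.\<close>

lemma add_01: "(a::'f) \<in> {0, 1} \<Longrightarrow> b \<in> {0, 1} \<Longrightarrow> a + b \<in> {0, 1}"
  by (auto simp: two_eq_0)

lemma sum_01: "(\<And>i. i \<in> A \<Longrightarrow> (f i :: 'f) \<in> {0, 1}) \<Longrightarrow> sum f A \<in> {0, 1}"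
proof (induction A rule: infinite_finite_induct)
  case (insert x A)
  then have "f x + sum f A \<in> {0, 1}" by (intro add_01) auto
  with insert show ?case by simp
qed auto

text \<open>Only the \<open>y n\<close> and the last link \<open>t\<close> are prescribed; the other
  \<open>s n\<close> are fresh preimages, which leaves the choice of \<open>c\<close>. The sum of
  the \<open>1 + \<alpha> n\<close> is 0 or 1: if it is 0, the chain closes with
  \<open>c = 1\<close>; if it is 1, the chain is first lengthened by one vector and closes with
  \<open>c = 0\<close>.\<close>

lemma three_idempotents_of_partial_chain:
  fixes y :: "nat \<Rightarrow> 'v"
  assumes u: "lin u" "infinite_dimensional scale" "finite_rank scale u"
    and N: "0 < N" and inj: "inj_on y {..<N}"
    and fin: "finite Z" and indep: "independent (y ` {..<N} \<union> {t} \<union> Z)"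
    and disj: "t \<notin> y ` {..<N}" "(y ` {..<N} \<union> {t}) \<inter> Z = {}"
    and ut: "u t = y (N - 1)" and uz: "\<And>z. z \<in> Z \<Longrightarrow> u z \<in> span {t}"
    and range: "range u = span (y ` {..<N} \<union> u ` Z)"
    and uy: "\<And>n. n < N \<Longrightarrow>
      u (y n) + (\<alpha> n *s y n + \<beta> n *s y (n - 1)) \<in> span ({t} \<union> y ` {Suc n..<N})"
    and \<beta>0: "\<beta> 0 = 0" and \<beta>: "(\<Sum>n<N. \<beta> n) = 0" and \<alpha>: "(\<Sum>n<N. \<alpha> n) \<in> {0, 1}"
  shows "three_idempotents u"
proof -
  let ?F = "y ` {..<N} \<union> {t} \<union> Z"
  have F: "finite ?F" using fin by simp
  have yr: "y n \<in> range u" if "n < N" for n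
    using that unfolding range by (auto intro: span_base)
  have sum01: "(\<Sum>n<N. 1 + \<alpha> n) \<in> {0, 1}"
    using add_01[OF of_nat_01 \<alpha>] by (simp add: sum.distrib)
  show ?thesis
  proof (cases "(\<Sum>n<N. 1 + \<alpha> n) = 0")
    case True
    \<comment> \<open>Links for \<open>c = 1\<close>. The last one is \<open>t\<close>, since
      \<open>u t = y (N - 1)\<close> has no successor term.\<close>
    obtain x where x: "\<forall>i<N - 1. u (x i) = y i + y (Suc i)" "inj_on x {..<N - 1}"
        "x ` {..<N - 1} \<inter> ?F = {}" "independent (?F \<union> x ` {..<N - 1})"
    proof -
      have "y i + y (Suc i) \<in> range u" if "i < N - 1" for i
        using that yr pair.linear_subspace_image[OF u(1) subspace_UNIV] by (intro subspace_add) auto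
      then show thesis
        using fresh_preimages[OF u F indep, of "N - 1" "\<lambda>i. y i + y (Suc i)"] that by blast
    qed
    define s where "s n = (if n = N - 1 then t else x n)" for n
    have sK: "s ` {..<N} = insert t (x ` {..<N - 1})"
      using N by (auto simp: s_def image_iff Bex_def)
    have us: "u (s n) = 1 *s y n + (if Suc n < N then y (Suc n) else 0)" if "n < N" for n
    proof (cases "n = N - 1")
      case True
      then show ?thesis using ut N by (auto simp: s_def)
    next
      case False
      then have "n < N - 1" "Suc n < N" using that by linarith+
      then show ?thesis using x(1) by (simp add: s_def)
    qed
    have all: "s ` {..<N} \<union> y ` {..<N} \<union> Z = ?F \<union> x ` {..<N - 1}" by (auto simp: sK)
    \<comment> \<open>Downward from \<open>n = N - 1\<close>, as \<open>u (s n)\<close> is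
      \<open>y n\<close> plus its successor.\<close>
    have "y n \<in> span (u ` (s ` {..<N} \<union> y ` {..<N} \<union> Z))" if "n < N" for n
      using that
    proof (induction "N - n" arbitrary: n rule: less_induct)
      case less
      have "u (s n) \<in> span (u ` (s ` {..<N} \<union> y ` {..<N} \<union> Z))"
        using less.prems by (auto intro: span_base)
      moreover have "(if Suc n < N then y (Suc n) else 0) \<in> span (u ` (s ` {..<N} \<union> y ` {..<N} \<union> Z))"
        using less by (auto simp: span_zero)
      ultimately show ?case
        using us[OF less.prems] by (simp add: span_add_eq2)
    qed
    then have "range u \<subseteq> span (u ` (s ` {..<N} \<union> y ` {..<N} \<union> Z))"
      unfolding range by (intro span_minimal) (auto intro: span_base)
    then obtain C where C: "C \<inter> (s ` {..<N} \<union> y ` {..<N} \<union> Z) = {}"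
        "independent (s ` {..<N} \<union> y ` {..<N} \<union> Z \<union> C)" "span (s ` {..<N} \<union> y ` {..<N} \<union> Z \<union> C) = UNIV"
        "\<And>z. z \<in> C \<Longrightarrow> u z = 0"
      using complete_by_kernel[OF u(1), of "s ` {..<N} \<union> y ` {..<N} \<union> Z"] x(4) unfolding all by blast
    have t: "{t} \<subseteq> s ` {..<N}" by (auto simp: sK)
    show ?thesis
    proof (rule three_idempotents_of_finite_chain[OF u(1) _ inj, of s "Z \<union> C" 1 \<alpha> \<beta>])
      show "inj_on s {..<N}"
        using x(2,3) by (auto simp: inj_on_def s_def)
      show "s ` {..<N} \<inter> y ` {..<N} = {}" using x(3) disj by (auto simp: sK)
      show "(s ` {..<N} \<union> y ` {..<N}) \<inter> (Z \<union> C) = {}" using x(3) disj C(1) by (auto simp: sK)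
      show "u (y n) + (\<alpha> n *s y n + \<beta> n *s y (n - 1)) \<in> span (s ` {..<N} \<union> y ` {Suc n..<N})"
        if "n < N" for n
        by (rule subsetD[OF span_mono uy[OF that]]) (use t in auto)
      show "u z \<in> span (s ` {..<N})" if "z \<in> Z \<union> C" for z
        using that C(4) subsetD[OF span_mono[OF t] uz] span_zero by (metis Un_iff)
      show "independent (s ` {..<N} \<union> y ` {..<N} \<union> (Z \<union> C))"
        "span (s ` {..<N} \<union> y ` {..<N} \<union> (Z \<union> C)) = UNIV"
        using C(2,3) by (simp_all only: Un_assoc not_False_eq_True)
    qed (fact us True \<beta>0 \<beta>)+
  next
    case False
    then have sum1: "(\<Sum>n<N. 1 + \<alpha> n) = 1" using sum01 by simp
    \<comment> \<open>The first \<open>N - 1\<close> preimages are links of the chain. The other two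
      are kernel vectors: \<open>x N\<close> is the new first vector, \<open>x (N - 1)\<close> the
      link that ends the chain.\<close>
    have "(if i < N - 1 then y i else 0) \<in> range u" for i
      using yr by (auto intro: range_eqI[of _ _ 0] simp: lin_simps[OF u(1)])
    then obtain x where x: "\<forall>i<N + 1. u (x i) = (if i < N - 1 then y i else 0)" "inj_on x {..<N + 1}"
        "x ` {..<N + 1} \<inter> ?F = {}" "independent (?F \<union> x ` {..<N + 1})"
      using fresh_preimages[OF u F indep, of "N + 1" "\<lambda>i. if i < N - 1 then y i else 0"] by blast
    define s where "s n = (if n = N - 1 then t else if n = N then x (N - 1) else x n)" for n
    define y' where "y' n = (case n of 0 \<Rightarrow> x N | Suc m \<Rightarrow> y m)" for n
    \<comment> \<open>The new first vector has diagonal entry 0, so it adds \<open>1 + 0\<close> to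
      the sum and turns 1 into 0.\<close>
    define \<alpha>' where "\<alpha>' n = (case n of 0 \<Rightarrow> 0 | Suc m \<Rightarrow> \<alpha> m)" for n
    define \<beta>' where "\<beta>' n = (case n of 0 \<Rightarrow> 0 | Suc m \<Rightarrow> \<beta> m)" for n
    note defs = y'_def \<alpha>'_def \<beta>'_def
    have sK: "s ` {..<Suc N} = insert t (x ` {..<N})"
    proof -
      obtain M where M: "N = Suc M" using N by (cases N) auto
      have "s ` {..<M} = x ` {..<M}" by (rule image_cong) (auto simp: s_def M)
      moreover have "s M = t" "s (Suc M) = x M" by (simp_all add: s_def M)
      ultimately show ?thesis by (simp only: M lessThan_Suc image_insert insert_commute)
    qed
    have yK: "y' ` {..<Suc N} = insert (x N) (y ` {..<N})"
      unfolding lessThan_Suc_eq_insert_0 by (simp add: y'_def image_image)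
    have us: "u (s n) = 0 *s y' n + (if Suc n < Suc N then y' (Suc n) else 0)" if "n < Suc N" for n
      using x(1) ut N that by (auto simp: s_def y'_def)
    let ?B = "s ` {..<Suc N} \<union> y' ` {..<Suc N} \<union> Z"
    have all: "?B = ?F \<union> x ` {..<N + 1}"
      unfolding sK yK by (auto simp: lessThan_Suc)
    have "y n \<in> span (u ` ?B)" if "n < N" for n
    proof -
      have "u (s n) = y n" using us[of n] that by (simp add: y'_def)
      then show ?thesis using that by (metis UnI1 image_eqI lessThan_iff less_SucI span_base)
    qed
    then have "range u \<subseteq> span (u ` ?B)"
      unfolding range by (intro span_minimal) (auto intro: span_base)
    then obtain C where C: "C \<inter> ?B = {}" "independent (?B \<union> C)" "span (?B \<union> C) = UNIV"
        "\<And>z. z \<in> C \<Longrightarrow> u z = 0"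
      using complete_by_kernel[OF u(1), of ?B] x(4) unfolding all by blast
    have t: "{t} \<subseteq> s ` {..<Suc N}" unfolding sK by simp
    have xN: "x N \<notin> ?F" "x N \<notin> x ` {..<N}" "x ` {..<N} \<inter> ?F = {}"
      using x(2,3) by (auto simp: lessThan_Suc)
    show ?thesis
    proof (rule three_idempotents_of_finite_chain[OF u(1), of s "Suc N" y' "Z \<union> C" 0 \<alpha>' \<beta>'])
      have xt: "x i \<noteq> t" if "i < N + 1" for i using x(3) that by auto
      show "inj_on s {..<Suc N}"
      proof (rule inj_onI)
        fix a b assume ab: "a \<in> {..<Suc N}" "b \<in> {..<Suc N}" "s a = s b"
        let ?f = "\<lambda>n. if n = N then N - 1 else n"
        have s: "s n = (if n = N - 1 then t else x (?f n))" for n using N by (simp add: s_def)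
        have f: "?f n < N + 1" if "n \<in> {..<Suc N}" for n using that by auto
        show "a = b"
        proof (cases "a = N - 1 \<or> b = N - 1")
          case True
          then show ?thesis using ab s xt[OF f] by metis
        next
          case False
          then have "?f a = ?f b"
            using inj_onD[OF x(2), of "?f a" "?f b"] f ab unfolding s by simp
          then show ?thesis using False by (simp split: if_splits)
        qed
      qed
      show "inj_on y' {..<Suc N}"
        unfolding lessThan_Suc_eq_insert_0 using inj xN(1)
        by (auto simp: y'_def inj_on_def image_iff dest: sym)
      show "s ` {..<Suc N} \<inter> y' ` {..<Suc N} = {}" unfolding sK yK using xN disj by auto
      show "(s ` {..<Suc N} \<union> y' ` {..<Suc N}) \<inter> (Z \<union> C) = {}" using xN disj C(1) unfolding sK yK by auto
      show "u (y' n) + (\<alpha>' n *s y' n + \<beta>' n *s y' (n - 1)) \<in> span (s ` {..<Suc N} \<union> y' ` {Suc n..<Suc N})"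
        if "n < Suc N" for n
      proof (cases n)
        case 0
        have "\<not> N < N - 1" by arith
        then have "u (x N) = 0" using x(1)[rule_format, of N] by simp
        then show ?thesis using 0 by (simp add: defs span_zero)
      next
        case (Suc m)
        have "\<beta>' n *s y' (n - 1) = \<beta> m *s y (m - 1)"
          using \<beta>0 by (cases m) (simp_all add: Suc defs)
        moreover have "y ` {Suc m..<N} \<subseteq> y' ` {Suc n..<Suc N}"
        proof
          fix v assume "v \<in> y ` {Suc m..<N}"
          then obtain i where "v = y' (Suc i)" "Suc i \<in> {Suc n..<Suc N}" by (auto simp: y'_def Suc)
          then show "v \<in> y' ` {Suc n..<Suc N}" by blast
        qed
        ultimately have "span ({t} \<union> y ` {Suc m..<N}) \<subseteq> span (s ` {..<Suc N} \<union> y' ` {Suc n..<Suc N})"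
          using t by (intro span_mono) blast
        moreover have "\<alpha>' n *s y' n + \<beta>' n *s y' (n - 1) = \<alpha> m *s y m + \<beta> m *s y (m - 1)" "y' n = y m"
          using \<open>\<beta>' n *s y' (n - 1) = _\<close> by (simp_all add: Suc defs)
        ultimately show ?thesis
          using uy[of m] that by (simp add: Suc subset_iff)
      qed
      show "u z \<in> span (s ` {..<Suc N})" if "z \<in> Z \<union> C" for z
        using that C(4) subsetD[OF span_mono[OF t] uz] span_zero by (metis Un_iff)
      show "(\<Sum>n<Suc N. 1 + \<alpha>' n) = 0" "(\<Sum>n<Suc N. \<beta>' n) = 0"
        using sum1 \<beta> by (simp_all add: sum.lessThan_Suc_shift defs two_eq_0 del: sum.lessThan_Suc)
      show "independent (s ` {..<Suc N} \<union> y' ` {..<Suc N} \<union> (Z \<union> C))"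
        "span (s ` {..<Suc N} \<union> y' ` {..<Suc N} \<union> (Z \<union> C)) = UNIV"
        using C(2,3) by (simp_all only: Un_assoc not_False_eq_True)
      show "\<beta>' 0 = 0" by (simp add: \<beta>'_def)
    qed (fact us)
  qed
qed


section \<open>The trace of a finite-rank endomorphism\<close>

lemma trace_basis_independent:
  assumes f: "lin f" and B: "independent B" "finite B" and C: "independent C" "finite C"
    and eq: "span B = span C" and fB: "\<And>b. b \<in> B \<Longrightarrow> f b \<in> span B"
  shows "(\<Sum>b\<in>B. representation B (f b) b) = (\<Sum>c\<in>C. representation C (f c) c)"
proof -
  have fs: "f v \<in> span B" if "v \<in> span B" for v
    using that by (induction rule: span_induct_alt) (auto simp: lin_simps[OF f] span_zero fB intro!: span_add span_scale)
  have CB: "c \<in> span B" if "c \<in> C" for c using that eq by (auto intro: span_base)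
  have BC: "b \<in> span C" if "b \<in> B" for b using that eq by (auto intro: span_base)
  \<comment> \<open>Both traces expand into the same double sum over \<open>B\<close> and
    \<open>C\<close>, as in \<open>tr (M N) = tr (N M)\<close>.\<close>
  have "representation B (f b) b = (\<Sum>c\<in>C. representation C (f b) c * representation B c b)" if b: "b \<in> B" for b
  proof -
    have "f b = (\<Sum>c\<in>C. representation C (f b) c *s c)"
      using sum_representation_eq[OF C(1) _ C(2), of "f b"] fB[OF b] eq by simp
    then have "representation B (f b) b = representation B (\<Sum>c\<in>C. representation C (f b) c *s c) b"
      by simp
    also have "\<dots> = (\<Sum>c\<in>C. representation C (f b) c * representation B c b)"
      by (simp add: representation_sum[OF B(1)] representation_scale[OF B(1)] span_scale CB)
    finally show ?thesis .
  qed
  moreover have "representation C (f c) c = (\<Sum>b\<in>B. representation C (f b) c * representation B c b)" if c: "c \<in> C" for c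
  proof -
    have "c = (\<Sum>b\<in>B. representation B c b *s b)"
      using sum_representation_eq[OF B(1) CB[OF c] B(2)] by simp
    then have "f c = (\<Sum>b\<in>B. representation B c b *s f b)"
      by (metis (no_types, lifting) pair.linear_scale[OF f] pair.linear_sum[OF f] sum.cong)
    then have "representation C (f c) c = representation C (\<Sum>b\<in>B. representation B c b *s f b) c"
      by simp
    also have "\<dots> = (\<Sum>b\<in>B. representation C (f b) c * representation B c b)"
      using fB eq
      by (simp add: representation_sum[OF C(1)] representation_scale[OF C(1)] span_scale mult.commute)
    finally show ?thesis .
  qed
  ultimately show ?thesis
    by (simp add: sum.swap[of _ C B])
qed

lemma chosen_basis:
  assumes "subspace S"
  shows "is_basis_of scale (SOME B. is_basis_of scale B S) S"
proof -
  obtain B where "B \<subseteq> S" "independent B" "S \<subseteq> span B"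
    using maximal_independent_subset by blast
  then have "is_basis_of scale B S"
    unfolding is_basis_of_def using assms by (metis span_eq span_superset subset_trans)
  then show ?thesis by (rule someI)
qed

lemma fr_trace_eq:
  assumes f: "lin f" and B: "independent B" "finite B" "span B = range f"
  shows "fr_trace scale f = (\<Sum>b\<in>B. representation B (f b) b)"
proof -
  define C where "C = (SOME C. is_basis_of scale C (range f))"
  have sub: "subspace (range f)" using pair.linear_subspace_image[OF f subspace_UNIV] .
  have "is_basis_of scale C (range f)"
    unfolding C_def by (rule chosen_basis[OF sub])
  then have C: "independent C" "span C = range f"
    unfolding is_basis_of_def using span_eq_iff[THEN iffD2, OF sub] by simp_all
  then have fC: "finite C"
    using independent_span_bound[OF B(2) C(1)] B(3) span_superset by metis
  show ?thesis
    unfolding fr_trace_def Let_def C_def[symmetric]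
    by (rule trace_basis_independent[OF f C(1) fC B(1,2)]) (use B(3) C(2) in auto)
qed

text \<open>A longest independent family of this form that starts at \<open>v\<close> spans the
  range. Otherwise it could be prolonged: by \<open>u\<close> of its last vector if that is new, by
  any new vector of the range if not. The finite rank bounds its length.\<close>

lemma hessenberg_basis:
  assumes u: "lin u" and fr: "finite_rank scale u" and nz: "v \<in> range u" "u v \<noteq> 0 \<or> v \<noteq> 0"
  obtains b :: "nat \<Rightarrow> 'v" and r where "0 < r" "inj_on b {..<r}" "independent (b ` {..<r})"
    "span (b ` {..<r}) = range u"
    "\<And>j. j < r \<Longrightarrow> u (b j) \<in> span (b ` {..j}) \<or> Suc j < r \<and> u (b j) = b (Suc j)" "b 0 = v"
proof -
  \<comment> \<open>The last index carries no condition: \<open>u\<close> of the last vector may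
    still leave the span, and then it becomes the next vector.\<close>
  define P where "P k b \<longleftrightarrow> inj_on b {..<k} \<and> independent (b ` {..<k}) \<and> b ` {..<k} \<subseteq> range u \<and> b 0 = v
    \<and> (\<forall>j. Suc j < k \<longrightarrow> u (b j) \<in> span (b ` {..j}) \<or> u (b j) = b (Suc j))" for k and b :: "nat \<Rightarrow> 'v"
  obtain R0 where R0: "finite R0" "span R0 = range u"
    using fr unfolding finite_rank_def by blast
  have bound: "k \<le> card R0" if "P k b" for k b
    using independent_span_bound[OF R0(1), of "b ` {..<k}"] that R0(2)
    by (simp add: P_def card_image)
  have "v \<noteq> 0" using nz by (auto simp: lin_simps[OF u])
  then have "P 1 (\<lambda>_. v)" using nz by (auto simp: P_def lessThan_Suc)
  then have ex: "\<exists>b. P 1 b" by blast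
  define r where "r = (GREATEST k. \<exists>b. P k b)"
  have "\<exists>b. P r b" unfolding r_def
    by (rule GreatestI_nat[where P = "\<lambda>k. \<exists>b. P k b", OF ex]) (use bound in blast)
  then obtain b where b: "P r b" by blast
  have max: "k \<le> r" if "P k c" for k c
    unfolding r_def by (rule Greatest_le_nat[where P = "\<lambda>k. \<exists>b. P k b"]) (use bound that in blast)+
  have r: "0 < r" using max[OF \<open>P 1 _\<close>] by simp
  \<comment> \<open>Applied first to \<open>w = u (b (r - 1))\<close>, then, through the first
    alternative, to every \<open>w\<close> in the range.\<close>
  have ext: "w \<in> span (b ` {..<r})" if w: "w \<in> range u"
    and or: "u (b (r - 1)) \<in> span (b ` {..r - 1}) \<or> u (b (r - 1)) = w" for w
  proof (rule ccontr)
    assume n: "w \<notin> span (b ` {..<r})"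
    then have n': "w \<notin> b ` {..<r}" by (auto intro: span_base)
    let ?c = "b(r := w)"
    have im: "?c ` {..<Suc r} = insert w (b ` {..<r})" by (auto simp: lessThan_Suc)
    have "inj_on ?c {..<Suc r}"
      using b n' by (auto simp: P_def inj_on_def less_Suc_eq)
    moreover have "independent (?c ` {..<Suc r})"
      unfolding im using b n by (intro independent_insertI) (auto simp: P_def)
    moreover have "u (?c j) \<in> span (?c ` {..j}) \<or> u (?c j) = ?c (Suc j)" if "Suc j < Suc r" for j
    proof -
      have "?c ` {..j} = b ` {..j}" by (rule image_cong) (use that in auto)
      then show ?thesis
        using b that or by (cases "Suc j = r") (auto simp: P_def)
    qed
    moreover have "?c ` {..<Suc r} \<subseteq> range u" unfolding im using b w by (simp add: P_def)
    moreover have "?c 0 = v" using b r by (simp add: P_def)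
    ultimately have "P (Suc r) ?c" unfolding P_def by blast
    then show False using max by fastforce
  qed
  have R: "{..r - 1} = {..<r}" using r by auto
  have last: "u (b (r - 1)) \<in> span (b ` {..r - 1})"
    using ext[of "u (b (r - 1))"] unfolding R by blast
  have "span (b ` {..<r}) = range u"
  proof
    show "span (b ` {..<r}) \<subseteq> range u"
      using b pair.linear_subspace_image[OF u subspace_UNIV] by (intro span_minimal) (simp_all add: P_def)
    show "range u \<subseteq> span (b ` {..<r})" using ext last by blast
  qed
  moreover have "u (b j) \<in> span (b ` {..j}) \<or> Suc j < r \<and> u (b j) = b (Suc j)" if "j < r" for j
    using b last that by (cases "Suc j < r") (auto simp: P_def not_less dest: le_antisym)
  ultimately show thesis
    using that[of r b] r b by (auto simp: P_def)
qed

lemma reflect_image: "(\<lambda>n. N - Suc n) ` {m..<N} = {..<N - m}" for N :: nat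
proof
  show "{..<N - m} \<subseteq> (\<lambda>n. N - Suc n) ` {m..<N}"
  proof
    fix i assume "i \<in> {..<N - m}"
    then show "i \<in> (\<lambda>n. N - Suc n) ` {m..<N}"
      by (intro image_eqI[of _ _ "N - Suc i"]) auto
  qed
qed auto

text \<open>Read backwards, a Hessenberg basis of the range is a partial chain. Its diagonal sums to
  the trace; its subdiagonal consists of zeros and ones and sums to a parity. If the parity is odd,
  \<open>b 0\<close> leaves the chain and serves as the last link \<open>t\<close>.\<close>

lemma three_idempotents_of_finite_rank:
  assumes u: "lin u" and inf: "infinite_dimensional scale" and fr: "finite_rank scale u"
    and tr: "fr_trace scale u \<in> {0, 1}"
  shows "three_idempotents u"
proof (cases "u = (\<lambda>x. 0)")
  case True
  then show ?thesis
    unfolding three_idempotents_def idempotent_endo_def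
    by (intro exI[of _ "\<lambda>x. 0"]) (auto simp: fun_eq_iff intro!: linI)
next
  case False
  then obtain v0 where v0: "u v0 \<noteq> 0" by auto
  \<comment> \<open>If the range contains a vector that is not an eigenvector, starting there forces
    \<open>u (b 0) = b 1\<close>, hence \<open>\<beta> 0 = 1\<close> and
    \<open>\<alpha> 0 = 0\<close>.\<close>
  define v where "v = (if \<exists>v\<in>range u. u v \<notin> span {v} then SOME v. v \<in> range u \<and> u v \<notin> span {v} else u v0)"
  have v: "v \<in> range u \<and> u v \<notin> span {v}" if "\<exists>v\<in>range u. u v \<notin> span {v}"
    using someI_ex[of "\<lambda>v. v \<in> range u \<and> u v \<notin> span {v}"] that unfolding v_def by auto
  have v1: "v \<in> range u \<and> v \<noteq> 0"
  proof (cases "\<exists>v\<in>range u. u v \<notin> span {v}")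
    case True
    then have "u v \<notin> span {v}" "v \<in> range u" using v by blast+
    moreover have "u v \<in> span {v}" if "v = 0" using that by (simp add: pair.linear_0[OF u])
    ultimately show ?thesis by blast
  next
    case False
    then show ?thesis using v0 unfolding v_def by simp
  qed
  then have v1: "v \<in> range u" "v \<noteq> 0" by auto
  obtain r and b :: "nat \<Rightarrow> 'v" where r: "0 < r" and inj: "inj_on b {..<r}" and ind: "independent (b ` {..<r})"
    and span: "span (b ` {..<r}) = range u"
    and hess: "\<And>j. j < r \<Longrightarrow> u (b j) \<in> span (b ` {..j}) \<or> Suc j < r \<and> u (b j) = b (Suc j)" and b0: "b 0 = v"
    by (rule hessenberg_basis[OF u fr v1(1) disjI2[OF v1(2)]]) (rule that)
  let ?B = "b ` {..<r}"
  define \<alpha> where "\<alpha> j = representation ?B (u (b j)) (b j)" for j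
  define \<beta> :: "nat \<Rightarrow> 'f" where "\<beta> j = (if u (b j) \<in> span (b ` {..j}) then 0 else 1)" for j
  have bS: "b j \<in> span (b ` A)" if "j \<in> A" for j A using that by (auto intro: span_base)
  have nmem: "b j \<notin> b ` A" if "j < r" "A \<subseteq> {..<r}" "j \<notin> A" for j A
    using inj_on_image_mem_iff[OF inj, of j A] that by simp
  have rep0: "representation ?B x (b j) = 0" if "x \<in> span (b ` A)" "j < r" "A \<subseteq> {..<r}" "j \<notin> A" for x j A
  proof -
    have "representation ?B x = representation (b ` A) x"
      by (rule representation_extend[OF ind that(1) image_mono[OF that(3)]])
    then show ?thesis using representation_ne_zero nmem[OF that(2-4)] by metis
  qed
  have urel: "u (b j) + (\<alpha> j *s b j + \<beta> j *s b (Suc j)) \<in> span (b ` {..<j})" if j: "j < r" for j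
  proof (cases "u (b j) \<in> span (b ` {..j})")
    case True
    then have "u (b j) \<in> span (insert (b j) (b ` {..<j}))"
      by (simp add: lessThan_Suc_atMost[symmetric] lessThan_Suc)
    then obtain k where k: "u (b j) - k *s b j \<in> span (b ` {..<j})"
      by (auto simp: span_breakdown_eq)
    have "representation ?B (u (b j) - k *s b j) (b j) = 0"
      by (rule rep0[OF k]) (use j in auto)
    moreover have "u (b j) \<in> span ?B" using span by auto
    ultimately have "\<alpha> j = k"
      using j by (simp add: \<alpha>_def representation_diff[OF ind] representation_scale[OF ind]
          representation_basis[OF ind] span_scale span_base)
    then show ?thesis using k True by (simp add: \<beta>_def vec_diff)
  next
    case False
    then have "Suc j < r" "u (b j) = b (Suc j)" using hess[OF j] by auto
    moreover from this have "b (Suc j) \<noteq> b j" using inj_onD[OF inj, of "Suc j" j] j by auto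
    ultimately have "\<alpha> j = 0"
      using j by (simp add: \<alpha>_def representation_basis[OF ind])
    then show ?thesis
      using False \<open>u (b j) = b (Suc j)\<close> by (simp add: \<beta>_def span_zero)
  qed
  have \<beta>last: "\<beta> (r - 1) = 0"
    using hess[of "r - 1"] r by (auto simp: \<beta>_def)
  have tr\<alpha>: "(\<Sum>j<r. \<alpha> j) \<in> {0, 1}"
    using tr fr_trace_eq[OF u ind _ span] inj by (simp add: sum.reindex \<alpha>_def)
  have sum\<beta>: "(\<Sum>j<r. \<beta> j) \<in> {0, 1}"
    by (rule sum_01) (simp add: \<beta>_def)
  obtain x where x: "u x = v" "x \<notin> span ?B"
    by (rule fresh_preimage[OF u inf fr finite_imageI[OF finite_lessThan] v1(1)])
  have xB: "x \<notin> ?B" using x(2) by (rule contrapos_nn) (rule span_base)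
  show ?thesis
  proof (cases "(\<Sum>j<r. \<beta> j) = 0")
    case True
    \<comment> \<open>Reversal turns the subdiagonal entry into the single backward term at
      \<open>y (n - 1)\<close>. The chain now ends in \<open>b 0 = v\<close>, whose link is
      \<open>x\<close>.\<close>
    let ?y = "\<lambda>n. b (r - Suc n)"
    have yim: "?y ` {m..<r} = b ` {..<r - m}" for m
      unfolding reflect_image[symmetric] image_image ..
    have yB: "?y ` {..<r} = ?B"
      using yim[of 0] by (simp add: atLeast0LessThan)
    show ?thesis
    proof (rule three_idempotents_of_partial_chain[OF u inf fr r, of ?y "{}" x "\<lambda>n. \<alpha> (r - Suc n)"
          "\<lambda>n. \<beta> (r - Suc n)"])
      show "inj_on ?y {..<r}"
        using inj_onD[OF inj, of "r - Suc i" "r - Suc k" for i k] by (intro inj_onI) fastforce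
      show "independent (?y ` {..<r} \<union> {x} \<union> {})"
        using ind x(2) unfolding yB by (simp add: independent_insertI)
      show "u (?y n) + (\<alpha> (r - Suc n) *s ?y n + \<beta> (r - Suc n) *s ?y (n - 1))
          \<in> span ({x} \<union> ?y ` {Suc n..<r})" if n: "n < r" for n
      proof -
        \<comment> \<open>For \<open>n = 0\<close> the two vectors differ, but their coefficient is
          \<open>\<beta> (r - 1) = 0\<close>.\<close>
        have eq: "\<beta> (r - Suc n) *s ?y (n - 1) = \<beta> (r - Suc n) *s b (Suc (r - Suc n))"
          using n \<beta>last by (cases n) (simp_all add: Suc_diff_Suc)
        have "u (?y n) + (\<alpha> (r - Suc n) *s ?y n + \<beta> (r - Suc n) *s ?y (n - 1)) \<in> span (?y ` {Suc n..<r})"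
          unfolding eq yim by (rule urel) (use r in simp)
        then show ?thesis by (rule subsetD[OF span_mono, rotated]) auto
      qed
      show "(\<Sum>n<r. \<beta> (r - Suc n)) = 0" "(\<Sum>n<r. \<alpha> (r - Suc n)) \<in> {0, 1}"
        using True tr\<alpha> by (simp_all only: sum.nat_diff_reindex)
      show "x \<notin> ?y ` {..<r}" unfolding yB by (rule xB)
      show "u x = ?y (r - 1)" using x(1) b0 r by simp
      show "range u = span (?y ` {..<r} \<union> u ` {})" by (simp add: yB span)
      show "\<beta> (r - Suc 0) = 0" using \<beta>last by simp
    qed simp_all
  next
    case False
    then have s1: "(\<Sum>j<r. \<beta> j) = 1" using sum\<beta> by simp
    \<comment> \<open>If every vector of the range were mapped into its own line, all
      \<open>\<beta> j\<close> would be 0.\<close>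
    have "\<exists>v\<in>range u. u v \<notin> span {v}"
    proof (rule ccontr)
      assume n: "\<not> ?thesis"
      have "\<beta> j = 0" if "j < r" for j
      proof -
        have "b j \<in> range u" using bS[of j "{..<r}"] that span by auto
        then have "u (b j) \<in> span {b j}" using n by blast
        then show ?thesis using span_mono[of "{b j}" "b ` {..j}"] by (auto simp: \<beta>_def)
      qed
      then show False using s1 by simp
    qed
    then have ne: "u (b 0) \<notin> span (b ` {..0})" using v b0 by simp
    then have r2: "1 < r" and ub0: "u (b 0) = b 1" using hess[OF r] by auto
    have \<beta>0: "\<beta> 0 = 1" using ne by (simp add: \<beta>_def)
    have \<alpha>0: "\<alpha> 0 = 0"
      using r2 inj by (auto simp: \<alpha>_def ub0 representation_basis[OF ind] inj_on_def)
    define N where "N = r - 1"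
    have rN: "r = Suc N" and N: "0 < N" using r2 by (simp_all add: N_def)
    \<comment> \<open>The chain now ends in \<open>b 1\<close>, linked by \<open>b 0\<close>; the
      preimage \<open>x\<close> of \<open>b 0\<close> goes into \<open>Z\<close>. Dropping
      \<open>b 0\<close> removes a 1 from the subdiagonal and a 0 from the diagonal.\<close>
    let ?y = "\<lambda>n. b (Suc (N - Suc n))"
    have "?y ` {m..<N} = (\<lambda>i. b (Suc i)) ` {..<N - m}" for m
      unfolding reflect_image[symmetric] image_image ..
    then have yim: "insert (b 0) (?y ` {m..<N}) = b ` {..<Suc (N - m)}" for m
      unfolding lessThan_Suc_eq_insert_0 by (simp add: image_image)
    have yB: "insert (b 0) (?y ` {..<N}) = ?B"
      using yim[of 0] by (simp add: atLeast0LessThan rN)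
    have yb0: "b 0 \<notin> ?y ` {..<N}"
      using inj_onD[OF inj, of 0 "Suc (N - Suc i)" for i] by (fastforce simp: rN)
    show ?thesis
    proof (rule three_idempotents_of_partial_chain[OF u inf fr N, of ?y "{x}" "b 0"
          "\<lambda>n. \<alpha> (Suc (N - Suc n))" "\<lambda>n. \<beta> (Suc (N - Suc n))"])
      show "inj_on ?y {..<N}"
        using inj_onD[OF inj, of "Suc (N - Suc i)" "Suc (N - Suc k)" for i k]
        by (intro inj_onI) (fastforce simp: rN)
      have all: "?y ` {..<N} \<union> {b 0} = ?B" using yB by auto
      show "independent (?y ` {..<N} \<union> {b 0} \<union> {x})"
        unfolding all using ind x(2) by (simp add: independent_insertI)
      show "(?y ` {..<N} \<union> {b 0}) \<inter> {x} = {}" unfolding all using xB by simp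
      show "range u = span (?y ` {..<N} \<union> u ` {x})"
        using x(1) b0 span yB by (simp add: insert_commute)
      show "u (?y n) + (\<alpha> (Suc (N - Suc n)) *s ?y n + \<beta> (Suc (N - Suc n)) *s ?y (n - 1))
          \<in> span ({b 0} \<union> ?y ` {Suc n..<N})" if n: "n < N" for n
      proof -
        have eq: "\<beta> (Suc (N - Suc n)) *s ?y (n - 1) = \<beta> (Suc (N - Suc n)) *s b (Suc (Suc (N - Suc n)))"
          using n \<beta>last by (cases n) (simp_all add: Suc_diff_Suc rN)
        have im: "{b 0} \<union> ?y ` {Suc n..<N} = b ` {..<Suc (N - Suc n)}" using yim[of "Suc n"] by simp
        show ?thesis unfolding eq im by (rule urel) (use n in \<open>simp add: rN\<close>)
      qed
      show "(\<Sum>n<N. \<beta> (Suc (N - Suc n))) = 0"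
        using s1 \<beta>0 unfolding rN sum.lessThan_Suc_shift
        by (simp add: sum.nat_diff_reindex[of "\<lambda>i. \<beta> (Suc i)"])
      show "(\<Sum>n<N. \<alpha> (Suc (N - Suc n))) \<in> {0, 1}"
        using tr\<alpha> \<alpha>0 unfolding rN sum.lessThan_Suc_shift
        by (simp add: sum.nat_diff_reindex[of "\<lambda>i. \<alpha> (Suc i)"])
      show "\<beta> (Suc (N - Suc 0)) = 0" using \<beta>last N by (simp add: rN)
      show "b 0 \<notin> ?y ` {..<N}" by (rule yb0)
      show "u (b 0) = ?y (N - 1)" using ub0 N by simp
      show "u z \<in> span {b 0}" if "z \<in> {x}" for z using that x(1) b0 by (auto intro: span_base)
    qed simp
  qed
qed

end

section \<open>Infinite rank\<close>

abbreviation card_le :: "'a set \<Rightarrow> 'b set \<Rightarrow> bool" (infix \<open>\<lesssim>\<close> 50) where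
  "A \<lesssim> B \<equiv> (card_of A, card_of B) \<in> ordLeq"

abbreviation card_less :: "'a set \<Rightarrow> 'b set \<Rightarrow> bool" (infix \<open>\<prec>\<close> 50) where
  "A \<prec> B \<equiv> (card_of A, card_of B) \<in> ordLess"

lemma card_le_trans: "A \<lesssim> B \<Longrightarrow> B \<lesssim> C \<Longrightarrow> A \<lesssim> C"
  by (rule ordLeq_transitive)

lemma card_less_iff: "A \<prec> B \<longleftrightarrow> \<not> B \<lesssim> A"
  by (rule not_ordLeq_iff_ordLess[symmetric]) (rule card_of_Well_order)+

lemma card_le_Un: "infinite C \<Longrightarrow> A \<lesssim> C \<Longrightarrow> B \<lesssim> C \<Longrightarrow> A \<union> B \<lesssim> C"
  by (rule card_of_Un_ordLeq_infinite_Field) (simp_all add: Field_card_of card_of_card_order_on)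

lemma finite_card_less: "finite A \<Longrightarrow> infinite B \<Longrightarrow> A \<prec> B"
  unfolding card_less_iff using card_of_ordLeq_finite by blast

lemma lists_length_card_le:
  assumes "infinite D"
  shows "{xs. set xs \<subseteq> D \<and> length xs = n} \<lesssim> D"
proof (induction n)
  case 0
  have "{xs. set xs \<subseteq> D \<and> length xs = 0} = {[]}" by auto
  then show ?case
    using finite_card_less[OF _ assms, of "{[]}"] ordLess_imp_ordLeq by simp
next
  case (Suc n)
  let ?L = "\<lambda>n. {xs. set xs \<subseteq> D \<and> length xs = n}"
  have "?L (Suc n) = (\<Union>x\<in>D. (#) x ` ?L n)"
    by (auto simp: length_Suc_conv)
  moreover have "(#) x ` ?L n \<lesssim> D" for x
    using card_of_image Suc.IH by (rule card_le_trans)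
  ultimately show ?case
    using card_of_UNION_ordLeq_infinite[OF assms, of D "\<lambda>x. (#) x ` ?L n"] card_of_mono1[of D D] by simp
qed

context vector_space begin

text \<open>For infinite \<open>D\<close>, the spans of finite lists over \<open>D\<close> cover
  \<open>A\<close>. There are no more such lists than elements of \<open>D\<close>, and by
  independence each span meets \<open>A\<close> in a finite set.\<close>

lemma independent_card_le:
  assumes A: "independent A" and D: "A \<subseteq> span D"
  shows "A \<lesssim> D"
proof (cases "finite D")
  case True
  then show ?thesis
    using independent_span_bound[OF True A D] inj_on_iff_card_le[of A D] card_of_ordLeq[of A D] by auto
next
  case False
  let ?L = "\<lambda>n. {xs. set xs \<subseteq> D \<and> length xs = n}"
  have "A \<subseteq> (\<Union>n::nat. \<Union>xs\<in>?L n. A \<inter> span (set xs))"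
  proof
    fix a assume a: "a \<in> A"
    then obtain t r where "finite t" "t \<subseteq> D" "a = (\<Sum>x\<in>t. r x *s x)"
      using D unfolding span_explicit by blast
    moreover from this have "a \<in> span t" by (auto intro: span_sum span_scale span_base)
    moreover obtain xs where "set xs = t" using finite_list[OF \<open>finite t\<close>] by blast
    ultimately show "a \<in> (\<Union>n::nat. \<Union>xs\<in>?L n. A \<inter> span (set xs))"
      using a by blast
  qed
  then have "A \<lesssim> (\<Union>n::nat. \<Union>xs\<in>?L n. A \<inter> span (set xs))" by (rule card_of_mono1)
  moreover have "A \<inter> span (set xs) \<lesssim> D" for xs
  proof -
    have "finite (A \<inter> span (set xs))"
      using independent_span_bound[of "set xs" "A \<inter> span (set xs)"] independent_mono[OF A] by auto
    then show ?thesis using finite_card_less[OF _ False] ordLess_imp_ordLeq by blast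
  qed
  then have "(\<Union>xs\<in>?L n. A \<inter> span (set xs)) \<lesssim> D" for n
    by (intro card_of_UNION_ordLeq_infinite[OF False lists_length_card_le[OF False]] ballI)
  then have "(\<Union>n::nat. \<Union>xs\<in>?L n. A \<inter> span (set xs)) \<lesssim> D"
    using False by (intro card_of_UNION_ordLeq_infinite) (auto simp: infinite_iff_card_of_nat)
  ultimately show ?thesis by (rule card_le_trans)
qed

end

section \<open>Infinite chains from an endomorphism of infinite rank\<close>

context char2_space begin

text \<open>If a maximal \<open>S\<close> for which \<open>S \<union> u ` S\<close> is independent were small, then \<open>u\<close> would act as a
  scalar modulo the small space \<open>span (S \<union> u ` S)\<close>.\<close>

lemma independent_with_image:
  assumes u: "lin u" and B: "infinite B" "independent B" "span B = range u"
    and large: "\<And>c D. range (\<lambda>x. u x - c *s x) \<subseteq> span D \<Longrightarrow> B \<lesssim> D"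
  obtains S where "S \<inter> u ` S = {}" "inj_on u S" "independent (S \<union> u ` S)" "B \<lesssim> S"
proof -
  note L = lin_simps[OF u]
  define P where "P S \<longleftrightarrow> S \<inter> u ` S = {} \<and> inj_on u S \<and> independent (S \<union> u ` S)" for S
  have "\<exists>M\<in>Collect P. \<forall>X\<in>Collect P. M \<subseteq> X \<longrightarrow> X = M"
  proof (rule subset_Zorn_nonempty)
    show "Collect P \<noteq> {}" by (auto simp: P_def independent_empty intro!: exI[of _ "{}"])
    fix \<C> assume ne: "\<C> \<noteq> {}" and ch: "subset.chain (Collect P) \<C>"
    have P: "P X" if "X \<in> \<C>" for X using ch that by (auto simp: subset.chain_def)
    have cmp: "X \<subseteq> Y \<or> Y \<subseteq> X" if "X \<in> \<C>" "Y \<in> \<C>" for X Y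
      using ch that by (auto simp: subset_chain_def)
    have two: "\<exists>Z\<in>\<C>. x \<in> Z \<and> y \<in> Z" if "x \<in> \<Union>\<C>" "y \<in> \<Union>\<C>" for x y
      using that cmp by blast
    have "\<Union>\<C> \<inter> u ` \<Union>\<C> = {}"
    proof (rule ccontr)
      assume "\<not> ?thesis"
      then obtain x y where "x \<in> \<Union>\<C>" "y \<in> \<Union>\<C>" "x = u y" by blast
      then obtain Z where "Z \<in> \<C>" "x \<in> Z" "y \<in> Z" using two by blast
      then show False using P[of Z] \<open>x = u y\<close> by (auto simp: P_def)
    qed
    moreover have "inj_on u (\<Union>\<C>)"
    proof (rule inj_onI)
      fix x y assume "x \<in> \<Union>\<C>" "y \<in> \<Union>\<C>" "u x = u y"
      then obtain Z where "Z \<in> \<C>" "x \<in> Z" "y \<in> Z" using two by blast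
      then show "x = y" using P[of Z] \<open>u x = u y\<close> by (auto simp: P_def dest: inj_onD)
    qed
    moreover have "independent (\<Union>X\<in>\<C>. X \<union> u ` X)"
    proof (rule independent_Union_directed)
      fix c d assume "c \<in> (\<lambda>X. X \<union> u ` X) ` \<C>" "d \<in> (\<lambda>X. X \<union> u ` X) ` \<C>"
      then obtain X Y where "X \<in> \<C>" "Y \<in> \<C>" and eq: "c = X \<union> u ` X" "d = Y \<union> u ` Y" by blast
      then have "X \<subseteq> Y \<or> Y \<subseteq> X" by (intro cmp)
      then show "c \<subseteq> d \<or> d \<subseteq> c" unfolding eq by blast
    qed (use P in \<open>auto simp: P_def\<close>)
    moreover have "(\<Union>X\<in>\<C>. X \<union> u ` X) = \<Union>\<C> \<union> u ` \<Union>\<C>" by blast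
    ultimately show "\<Union>\<C> \<in> Collect P" by (simp add: P_def)
  qed
  then obtain S where S: "P S" and max: "\<And>X. P X \<Longrightarrow> S \<subseteq> X \<Longrightarrow> X = S" by blast
  define D where "D = S \<union> u ` S"
  \<comment> \<open>If \<open>u v\<close> were not a multiple of \<open>v\<close> modulo the span of
    \<open>D\<close>, then \<open>v\<close> could be added to the maximal set
    \<open>S\<close>.\<close>
  have step: "\<exists>k. u v - k *s v \<in> span D" if v: "v \<notin> span D" for v
  proof (rule ccontr)
    assume n: "\<not> ?thesis"
    then have n': "u v \<notin> span (insert v D)" by (simp add: span_breakdown_eq)
    have D': "insert v S \<union> u ` insert v S = insert (u v) (insert v D)" by (auto simp: D_def)
    have "independent (insert v S \<union> u ` insert v S)"
      unfolding D' using S v n' by (intro independent_insertI) (auto simp: P_def D_def)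
    moreover have "v \<notin> D" using v by (rule contrapos_nn) (rule span_base)
    moreover have "u v \<notin> insert v D" using n' by (rule contrapos_nn) (rule span_base)
    ultimately have ni: "v \<notin> S" "v \<notin> u ` S" "u v \<notin> S" "u v \<notin> u ` S" "u v \<noteq> v"
      and ind: "independent (insert v S \<union> u ` insert v S)"
      by (simp_all add: D_def)
    have "inj_on u (insert v S)"
      using S ni by (simp add: P_def inj_on_insert)
    moreover have "insert v S \<inter> u ` insert v S = {}"
      using S ni by (simp add: P_def)
    ultimately have "P (insert v S)" using ind by (simp add: P_def)
    then have "insert v S = S" by (rule max) blast
    then show False using ni(1) by blast
  qed
  have "B \<lesssim> S"
  proof (rule ccontr)
    assume "\<not> ?thesis"
    then have lt: "S \<prec> B" by (simp add: card_less_iff)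
    moreover have "u ` S \<prec> B" using card_of_image lt by (rule ordLeq_ordLess_trans)
    ultimately have DB: "D \<prec> B" unfolding D_def by (rule card_of_Un_ordLess_infinite[OF B(1)])
    have small: "\<exists>v. v \<notin> span E" if "E \<prec> B" for E
    proof (rule ccontr)
      assume "\<not> ?thesis"
      then have "B \<subseteq> span E" by blast
      then have "B \<lesssim> E" by (rule independent_card_le[OF B(2)])
      then show False using that by (simp add: card_less_iff)
    qed
    \<comment> \<open>All scalars from \<open>step\<close> agree: a vector outside the span of
      \<open>v1\<close> and \<open>D\<close> is compared with \<open>v1\<close> through their sum,
      and a vector inside that span is moved outside by adding \<open>v2\<close>.\<close>
    obtain v1 where v1: "v1 \<notin> span D" using small[OF DB] by blast
    have "insert v1 D = {v1} \<union> D" by simp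
    moreover have "{v1} \<union> D \<prec> B"
      by (intro card_of_Un_ordLess_infinite[OF B(1)] finite_card_less DB B(1)) simp
    ultimately obtain v2 where v2: "v2 \<notin> span (insert v1 D)" using small by metis
    obtain c where c: "u v1 - c *s v1 \<in> span D" using step[OF v1] by blast
    have far: "u x - c *s x \<in> span D" if x: "x \<notin> span (insert v1 D)" for x
    proof -
      have "x \<notin> span D" using x span_mono[of D "insert v1 D"] by blast
      then obtain a where a: "u x - a *s x \<in> span D" using step by blast
      have "x + v1 \<notin> span D"
      proof
        assume "x + v1 \<in> span D"
        then have "x - (- 1) *s v1 \<in> span D" by simp
        then show False using x span_breakdown_eq[of x v1 D] by blast
      qed
      then obtain b where b: "u (x + v1) - b *s (x + v1) \<in> span D" using step by blast
      have "(u (x + v1) - b *s (x + v1)) - (u x - a *s x) - (u v1 - c *s v1) \<in> span D"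
        by (intro span_diff a b c)
      moreover have "(u (x + v1) - b *s (x + v1)) - (u x - a *s x) - (u v1 - c *s v1)
          = (a - b) *s x + (c - b) *s v1"
        by (simp add: L algebra_simps)
      ultimately have 1: "(a - b) *s x + (c - b) *s v1 \<in> span D" by simp
      have "a = b"
      proof (rule ccontr)
        assume ne: "a \<noteq> b"
        have "inverse (a - b) *s ((a - b) *s x + (c - b) *s v1) \<in> span D"
          by (rule span_scale[OF 1])
        then have "x - (- (inverse (a - b) * (c - b))) *s v1 \<in> span D"
          using ne by (simp add: scale_right_distrib)
        then show False using x span_breakdown_eq[of x v1 D] by blast
      qed
      moreover have "c = b"
      proof (rule ccontr)
        assume ne: "c \<noteq> b"
        have "inverse (c - b) *s ((c - b) *s v1) \<in> span D"
          by (rule span_scale) (use 1 \<open>a = b\<close> in simp)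
        then show False using v1 ne by simp
      qed
      ultimately show ?thesis using a by simp
    qed
    have "u x - c *s x \<in> span D" for x
    proof (cases "x \<in> span (insert v1 D)")
      case True
      then have "x + v2 \<notin> span (insert v1 D)" using v2 by (simp add: span_add_eq)
      from span_diff[OF far[OF this] far[OF v2]] show ?thesis by (simp add: L algebra_simps)
    next
      case False
      then show ?thesis by (rule far)
    qed
    then have "B \<lesssim> D" by (intro large) auto
    then show False using DB by (simp add: card_less_iff)
  qed
  then show thesis using that[of S] S unfolding P_def by blast
qed

text \<open>Part \<open>S1\<close> of \<open>S\<close> supplies the \<open>s\<close> of all chains,
  and its image supplies every \<open>y\<close> but the first ones. Those are the remaining basis
  vectors \<open>C\<close>; as \<open>C\<close> and \<open>S1\<close> have the same infinite
  cardinality, \<open>S1\<close> splits into sequences indexed by \<open>C\<close>.\<close>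

lemma three_idempotents_of_infinite_rank:
  assumes u: "lin u" and B: "infinite B" "independent B" "span B = range u"
    and large: "\<And>c D. range (\<lambda>x. u x - c *s x) \<subseteq> span D \<Longrightarrow> B \<lesssim> D"
  shows "three_idempotents u"
proof -
  obtain S where S: "S \<inter> u ` S = {}" "inj_on u S" "independent (S \<union> u ` S)" and BS: "B \<lesssim> S"
    by (rule independent_with_image[OF assms])
  have iS: "infinite S" using BS B(1) card_of_ordLeq_finite by blast
  have "B \<subseteq> range u" using B(3) span_superset by blast
  then obtain G where G: "inj_on u G" "u ` G = B" by (metis subset_image_inj)
  have GS: "G \<lesssim> S" using card_of_ordIsoI[of u G B] G BS ordIso_ordLeq_trans by (metis bij_betw_def)
  \<comment> \<open>\<open>B\<close> is included so that the range of \<open>u\<close> lies in the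
    span of \<open>B1\<close>, and its preimages \<open>G\<close> so that \<open>u\<close> maps that
    span onto the range; the rest of a basis then comes from the kernel.\<close>
  let ?U = "S \<union> u ` S \<union> B \<union> G"
  have US: "?U \<lesssim> S"
    using card_of_mono1[of S S] by (intro card_le_Un iS BS GS card_of_image) simp
  obtain B1 where B1: "S \<union> u ` S \<subseteq> B1" "B1 \<subseteq> ?U" "independent B1" "?U \<subseteq> span B1"
    using maximal_independent_subset_extend[of "S \<union> u ` S" ?U] S(3) by blast
  \<comment> \<open>Two disjoint copies of \<open>S\<close> inside \<open>S\<close>: the first
    becomes \<open>S1\<close>, the second makes \<open>C\<close> as large as
    \<open>S\<close>.\<close>
  obtain h where h: "bij_betw h (S <+> S) S"
    using card_of_Plus_infinite[OF iS, of S] card_of_ordIso card_of_mono1[of S S] by auto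
  define S1 where "S1 = h ` Inl ` S"
  define C where "C = B1 - (S1 \<union> u ` S1)"
  have hi: "inj_on h (S <+> S)" and hS: "h ` (S <+> S) = S" using h by (simp_all add: bij_betw_def)
  have S1S: "S1 \<subseteq> S" using hS unfolding S1_def by auto
  have "h ` Inr ` S \<inter> h ` Inl ` S = h ` (Inr ` S \<inter> Inl ` S)"
    by (rule inj_on_image_Int[OF hi, symmetric]) auto
  then have "h ` Inr ` S \<inter> S1 = {}" by (auto simp: S1_def)
  moreover have "h ` Inr ` S \<subseteq> S" using hS by auto
  moreover have "S - S1 \<subseteq> C" using B1(1) S(1) S1S unfolding C_def by blast
  ultimately have "h ` Inr ` S \<subseteq> C" by blast
  then have "h ` Inr ` S \<lesssim> C" by (rule card_of_mono1)
  moreover have "S \<lesssim> h ` Inr ` S"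
  proof (rule card_of_ordLeqI[of "h \<circ> Inr"])
    show "inj_on (h \<circ> Inr) S" by (intro comp_inj_on inj_on_subset[OF hi]) auto
  qed auto
  ultimately have SC: "S \<lesssim> C" using card_le_trans by blast
  then have iC: "infinite C" using iS card_of_ordLeq_finite by blast
  have "C \<subseteq> ?U" using B1(2) by (auto simp: C_def)
  then have CS: "C \<lesssim> S" using US card_of_mono1 card_le_trans by blast
  have "(card_of (C \<times> (UNIV :: nat set)), card_of S1) \<in> ordIso"
  proof -
    have "(card_of (C \<times> (UNIV :: nat set)), card_of C) \<in> ordIso"
      using card_of_Times_infinite[OF iC, of "UNIV :: nat set"] iC by (simp add: infinite_iff_card_of_nat)
    moreover have "(card_of C, card_of S) \<in> ordIso" using SC CS by (simp add: ordIso_iff_ordLeq)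
    moreover have "(card_of S, card_of S1) \<in> ordIso"
    proof (rule card_of_ordIsoI[of "h \<circ> Inl"])
      show "bij_betw (h \<circ> Inl) S S1"
        unfolding bij_betw_def S1_def
        by (intro conjI comp_inj_on inj_on_subset[OF hi]) (auto simp: image_comp)
    qed
    ultimately show ?thesis using ordIso_transitive by blast
  qed
  then obtain \<phi> where \<phi>: "bij_betw \<phi> (C \<times> (UNIV :: nat set)) S1"
    using card_of_ordIso by blast
  define y where "y k = (case k of (c, 0) \<Rightarrow> c | (c, Suc n) \<Rightarrow> u (\<phi> (c, n)))" for k
  let ?K = "C \<times> (UNIV :: nat set)"
  have \<phi>i: "inj_on \<phi> ?K" and \<phi>S: "\<phi> ` ?K = S1" using \<phi> by (auto simp: bij_betw_def)
  have y0: "y (c, 0) = c" and yS: "y (c, Suc n) = u (\<phi> (c, n))" for c n by (simp_all add: y_def)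
  have yim: "y ` ?K = C \<union> u ` S1"
  proof
    show "y ` ?K \<subseteq> C \<union> u ` S1"
    proof
      fix v assume "v \<in> y ` ?K"
      then obtain c n where "c \<in> C" "v = y (c, n)" by blast
      then show "v \<in> C \<union> u ` S1" using \<phi>S by (cases n) (auto simp: y0 yS)
    qed
    have "u (\<phi> k) \<in> y ` ?K" if "k \<in> ?K" for k
      using that by (intro image_eqI[of _ _ "(fst k, Suc (snd k))"]) (auto simp: yS)
    moreover have "c \<in> y ` ?K" if "c \<in> C" for c
      using that by (intro image_eqI[of _ _ "(c, 0)"]) (simp_all add: y0)
    ultimately show "C \<union> u ` S1 \<subseteq> y ` ?K" unfolding \<phi>S[symmetric] by blast
  qed
  have all: "\<phi> ` ?K \<union> y ` ?K = B1"
    unfolding \<phi>S yim using B1(1) S1S by (auto simp: C_def)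
  have yi: "inj_on y ?K"
  proof (rule inj_onI)
    fix k l assume k: "k \<in> ?K" and l: "l \<in> ?K" and eq: "y k = y l"
    obtain c m d n where [simp]: "k = (c, m)" "l = (d, n)" by (cases k, cases l) auto
    have uS1: "u (\<phi> (c, i)) \<in> u ` S1" "u (\<phi> (d, i)) \<in> u ` S1" for i
      using k l unfolding \<phi>S[symmetric] by auto
    have nC: "c \<notin> u ` S1" "d \<notin> u ` S1" using k l by (auto simp: C_def)
    show "k = l"
    proof (cases m)
      case 0
      have "n = 0"
      proof (rule ccontr)
        assume "n \<noteq> 0"
        then obtain j where "n = Suc j" by (cases n) auto
        then have "c = u (\<phi> (d, j))" using eq 0 by (simp add: y0 yS)
        then show False using uS1(2)[of j] nC(1) by simp
      qed
      then show ?thesis using eq 0 by (simp add: y0)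
    next
      case (Suc i)
      have "n \<noteq> 0"
      proof
        assume "n = 0"
        then have "u (\<phi> (c, i)) = d" using eq Suc by (simp add: y0 yS)
        then show False using uS1(1)[of i] nC(2) by simp
      qed
      then obtain j where n: "n = Suc j" by (cases n) auto
      have kl: "(c, i) \<in> ?K" "(d, j) \<in> ?K" using k l by auto
      then have "\<phi> (c, i) \<in> S1" "\<phi> (d, j) \<in> S1" unfolding \<phi>S[symmetric] by (simp_all only: imageI)
      then have S': "\<phi> (c, i) \<in> S" "\<phi> (d, j) \<in> S" using S1S by auto
      have "u (\<phi> (c, i)) = u (\<phi> (d, j))" using eq by (simp add: Suc n yS)
      then have "\<phi> (c, i) = \<phi> (d, j)" using S' by (rule inj_onD[OF S(2)])
      then have "(c, i) = (d, j)" using kl by (rule inj_onD[OF \<phi>i])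
      then show ?thesis by (simp add: Suc n)
    qed
  qed
  have disj: "\<phi> ` ?K \<inter> y ` ?K = {}"
    unfolding \<phi>S yim using S(1) S1S by (auto simp: C_def)
  have "range u = u ` span G"
    using B(3) G(2) pair.linear_span_image[OF u] by metis
  also have "\<dots> \<subseteq> u ` span B1"
    using B1(4) by (intro image_mono span_minimal) auto
  also have "\<dots> = span (u ` B1)" using pair.linear_span_image[OF u] by simp
  finally obtain Z where Z: "Z \<inter> B1 = {}" "independent (B1 \<union> Z)" "span (B1 \<union> Z) = UNIV"
      "\<And>z. z \<in> Z \<Longrightarrow> u z = 0"
    using complete_by_kernel[OF u B1(3)] by blast
  have "range u \<subseteq> span B1"
    unfolding B(3)[symmetric] using B1(4) by (intro span_minimal) auto
  then have uB1: "u v \<in> span B1" for v by blast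
  show ?thesis
    by (rule three_idempotents_of_infinite_chains[OF u \<phi>i yi disj, of Z, unfolded all])
      (use Z yS uB1 in auto)
qed

end

section \<open>The equivalence\<close>

context char2_space begin

text \<open>In characteristic 2 the map \<open>1 + e\<close> is idempotent along with
  \<open>e\<close>, so one summand absorbs the identity.\<close>

lemma three_idempotents_add_id:
  assumes "three_idempotents (\<lambda>x. u x - 1 *s x)"
  shows "three_idempotents u"
proof -
  obtain e1 e2 e3 where e: "idempotent_endo scale e1" "idempotent_endo scale e2" "idempotent_endo scale e3"
    and eq: "\<And>x. u x - 1 *s x = e1 x + e2 x + e3 x"
    using assms unfolding three_idempotents_def fun_eq_iff by blast
  have l: "lin e1" and ee: "\<And>x. e1 (e1 x) = e1 x" using e(1) by (auto simp: idempotent_endo_def fun_eq_iff)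
  have "idempotent_endo scale (\<lambda>x. x + e1 x)"
    unfolding idempotent_endo_def
    by (auto intro!: linI simp: fun_eq_iff lin_simps[OF l] ee scale_right_distrib ac_simps)
  moreover have "u x = x + e1 x + e2 x + e3 x" for x
    using eq[of x] by (simp add: algebra_simps)
  ultimately show ?thesis using e unfolding three_idempotents_def by blast
qed

lemma lin_minus_scale: "lin u \<Longrightarrow> lin (\<lambda>x. u x - c *s x)"
  by (intro linI) (simp_all add: lin_simps algebra_simps)

lemma range_basis:
  assumes "lin w" and "B = (SOME B. is_basis_of scale B (range w))"
  shows "independent B" "span B = range w"
proof -
  have sub: "subspace (range w)" using pair.linear_subspace_image[OF assms(1) subspace_UNIV] .
  have "is_basis_of scale B (range w)"
    unfolding assms(2) by (rule chosen_basis[OF sub])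
  then show "independent B" "span B = range w"
    unfolding is_basis_of_def using span_eq_iff[THEN iffD2, OF sub] by simp_all
qed

lemma UNIV_basis:
  assumes "B = (SOME B. is_basis_of scale B UNIV)"
  shows "independent B" "span B = UNIV"
  using chosen_basis[OF subspace_UNIV, folded assms] by (simp_all add: is_basis_of_def)

text \<open>Subtract a scalar \<open>c\<close> from \<open>{0, 1}\<close> that leaves finite rank or
  at most the rank left by the other one. By \<open>dom\<close> the remaining scalars leave full
  rank, so in the infinite case no further subtraction lowers the rank. In the finite case
  \<open>tr\<close> supplies the trace condition.\<close>

lemma three_idempotents_if:
  assumes u: "lin u" and inf: "infinite_dimensional scale"
    and dom: "\<And>c. c \<notin> {0, 1} \<Longrightarrow> \<not> dominant_eigenvalue scale u c"
    and tr: "\<And>c. c \<in> {0, 1} \<Longrightarrow> finite_rank scale (\<lambda>x. u x - c *s x) \<Longrightarrow>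
      fr_trace scale (\<lambda>x. u x - c *s x) \<in> {0, 1}"
  shows "three_idempotents u"
proof -
  define B where "B c = (SOME B. is_basis_of scale B (range (\<lambda>x. u x - c *s x)))" for c
  define D where "D = (SOME B. is_basis_of scale B (UNIV :: 'v set))"
  have B: "independent (B c)" "span (B c) = range (\<lambda>x. u x - c *s x)" for c
    using range_basis[OF lin_minus_scale[OF u] B_def] by blast+
  have D: "independent D" "span D = UNIV" using UNIV_basis[OF D_def] .
  have DB: "D \<lesssim> B c" if "c \<notin> {0, 1}" for c
    using dom[OF that]
    by (simp add: dominant_eigenvalue_def rk_def dimc_def card_less_iff flip: B_def D_def)
  have BD: "B c \<lesssim> D" for c
    by (rule independent_card_le[OF B(1)]) (simp add: D)
  have fin: "finite_rank scale (\<lambda>x. u x - c *s x)" if "finite (B c)" for c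
    unfolding finite_rank_def using that B(2) by blast
  have Bself: "B c \<lesssim> B c" for c by (rule card_of_mono1) simp
  have inf': "three_idempotents (\<lambda>x. u x - c *s x)"
    if i: "infinite (B c)" and c: "c \<in> {0, 1}" and le: "B c \<lesssim> B (1 - c)" for c
  proof (rule three_idempotents_of_infinite_rank[OF lin_minus_scale[OF u] i B])
    fix d E assume E: "range (\<lambda>x. u x - c *s x - d *s x) \<subseteq> span E"
    have eq: "(\<lambda>x. u x - c *s x - d *s x) = (\<lambda>x. u x - (c + d) *s x)"
      by (simp add: algebra_simps)
    have "span (B (c + d)) \<subseteq> span E" using E unfolding B(2) eq .
    then have "B (c + d) \<lesssim> E"
      using span_superset[of "B (c + d)"] by (intro independent_card_le[OF B(1)]) blast
    moreover have "B c \<lesssim> B (c + d)"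
    proof (cases "c + d \<in> {0, 1}")
      case True
      then have "c + d = c \<or> c + d = 1 - c" using c by auto
      then show ?thesis using le Bself by metis
    next
      case False
      then show ?thesis using card_le_trans[OF BD DB] by blast
    qed
    ultimately show "B c \<lesssim> E" using card_le_trans by blast
  qed
  have fin': "three_idempotents (\<lambda>x. u x - c *s x)" if "finite (B c)" and c: "c \<in> {0, 1}" for c
    by (rule three_idempotents_of_finite_rank[OF lin_minus_scale[OF u] inf fin[OF that(1)] tr[OF c fin[OF that(1)]]])
  have "\<exists>c\<in>{0, 1}. finite (B c) \<or> B c \<lesssim> B (1 - c)"
  proof (cases "B 0 \<lesssim> B 1")
    case False
    then have "B 1 \<lesssim> B 0" using card_less_iff ordLess_imp_ordLeq by blast
    then show ?thesis by auto
  qed auto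
  then obtain c :: 'f where c: "c \<in> {0, 1}" "three_idempotents (\<lambda>x. u x - c *s x)"
    using inf' fin' by blast
  then show ?thesis
    using three_idempotents_add_id by auto
qed

section \<open>Necessity: traces of idempotents and a stable subspace\<close>

lemma idempotent_trace:
  assumes e: "lin e" "\<And>x. e (e x) = e x" and Q: "finite Q" "independent Q"
    and inv: "\<And>x. x \<in> Q \<Longrightarrow> e x \<in> span Q"
  shows "(\<Sum>b\<in>Q. representation Q (e b) b) \<in> {0, 1}"
proof -
  \<comment> \<open>The images of \<open>Q\<close> under \<open>e\<close> and \<open>1 + e\<close>
    consist of fixed vectors and kernel vectors of \<open>e\<close>; in a basis chosen among them
    the diagonal entries are 0 or 1.\<close>
  let ?F = "e ` Q \<union> (\<lambda>x. x + e x) ` Q"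
  obtain C where C: "C \<subseteq> ?F" "independent C" "?F \<subseteq> span C"
    using maximal_independent_subset by blast
  have fC: "finite C" using C(1) Q(1) by (meson finite_UnI finite_imageI finite_subset)
  have ec: "e c = c \<or> e c = 0" if "c \<in> C" for c
    using C(1) that by (auto simp: e lin_simps[OF e(1)])
  have "span Q = span C"
    unfolding span_eq
  proof
    show "Q \<subseteq> span C"
    proof
      fix x assume "x \<in> Q"
      then have "e x \<in> span C" "x + e x \<in> span C" using C(3) by auto
      then show "x \<in> span C" using span_add_eq2 by blast
    qed
    have "?F \<subseteq> span Q" using inv by (auto intro: span_add span_base)
    then show "C \<subseteq> span Q" using C(1) by blast
  qed
  then have "(\<Sum>b\<in>Q. representation Q (e b) b) = (\<Sum>c\<in>C. representation C (e c) c)"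
    by (intro trace_basis_independent e(1) Q C(2) fC inv)
  also have "\<dots> \<in> {0, 1}"
  proof (rule sum_01)
    fix c assume c: "c \<in> C"
    show "representation C (e c) c \<in> {0, 1}"
      using ec[OF c] c by (auto simp: representation_basis[OF C(2)] representation_zero)
  qed
  finally show ?thesis .
qed

text \<open>Modulo \<open>w\<close>, idempotence of \<open>E = A + B + c + w\<close> says that \<open>A B + B A\<close> is the scalar
  \<open>c\<^sup>2 + c\<close>. Hence the subspace below is stable, and on the quotient by it that scalar vanishes.\<close>

lemma sum_of_idempotents_invariant_subspace:
  assumes A: "lin A" "\<And>x. A (A x) = A x" and B: "lin B" "\<And>x. B (B x) = B x"
    and E: "lin E" "\<And>x. E (E x) = E x"
    and w: "\<And>x. w x = A x + B x + E x - c *s x" and R: "span R = range w"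
  defines "W \<equiv> span (R \<union> A ` R \<union> B ` R \<union> (\<lambda>x. A (B x)) ` R)"
  shows "\<And>x. x \<in> W \<Longrightarrow> A x \<in> W" "\<And>x. x \<in> W \<Longrightarrow> B x \<in> W" "\<And>x. x \<in> W \<Longrightarrow> E x \<in> W"
    "\<And>x. (c * c + c) *s x \<in> W"
proof -
  note L = lin_simps[OF A(1)] lin_simps[OF B(1)] lin_simps[OF E(1)]
  have wW: "w x \<in> W" for x
    using R span_mono[of R "R \<union> A ` R \<union> B ` R \<union> (\<lambda>x. A (B x)) ` R"] unfolding W_def by blast
  have AwW: "A (w x) \<in> W" and BwW: "B (w x) \<in> W" for x
  proof -
    have "A (w x) \<in> span (A ` R)" "B (w x) \<in> span (B ` R)"
      using R pair.linear_span_image[OF A(1), of R] pair.linear_span_image[OF B(1), of R] by auto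
    moreover have "span (A ` R) \<subseteq> W" "span (B ` R) \<subseteq> W"
      unfolding W_def by (intro span_mono; auto)+
    ultimately show "A (w x) \<in> W" "B (w x) \<in> W" by blast+
  qed
  note add = span_add[of _ "R \<union> A ` R \<union> B ` R \<union> (\<lambda>x. A (B x)) ` R", folded W_def]
  note scl = span_scale[of _ "R \<union> A ` R \<union> B ` R \<union> (\<lambda>x. A (B x)) ` R", folded W_def]
  note base = span_base[of _ "R \<union> A ` R \<union> B ` R \<union> (\<lambda>x. A (B x)) ` R", folded W_def]
  have Ev: "E x = A x + B x + c *s x + w x" for x
    unfolding w by (simp add: vec_diff ac_simps)
  have z: "A (B x) + B (A x) + (c * c + c) *s x \<in> W" for x
  proof -
    have "E (E x) + E x = 0" by (simp add: E(2))
    moreover have "E (E x) + E x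
        = (A (B x) + B (A x) + (c * c + c) *s x) + (A (w x) + B (w x) + c *s w x + w (E x) + w x)"
      unfolding Ev[of "E x"] unfolding Ev[of x]
      by (simp add: L A(2) B(2) scale_right_distrib scale_left_distrib ac_simps)
    ultimately have "A (B x) + B (A x) + (c * c + c) *s x = A (w x) + B (w x) + c *s w x + w (E x) + w x"
      by (subst vec_eq_iff) simp
    then show ?thesis using wW AwW BwW add scl by simp
  qed
  \<comment> \<open>\<open>z\<close> trades \<open>B A\<close> for \<open>A B\<close> modulo
    \<open>W\<close>, which is why four families of generators suffice for stability under
    \<open>B\<close>.\<close>
  have BA: "B (A x) \<in> W" if "x \<in> W" "A (B x) \<in> W" for x
  proof -
    have "(A (B x) + B (A x) + (c * c + c) *s x) + (A (B x) + (c * c + c) *s x) \<in> W"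
      by (intro add z scl that)
    then show ?thesis by (simp add: ac_simps)
  qed
  show AW: "A x \<in> W" if "x \<in> W" for x
    using that unfolding W_def
    by (induction rule: span_induct_alt)
      (auto simp: L A(2) span_zero intro!: span_add span_scale intro: span_base)
  have gen: "B x \<in> W" if x: "x \<in> R \<union> A ` R \<union> B ` R \<union> (\<lambda>x. A (B x)) ` R" for x
  proof -
    consider r where "r \<in> R" "x = r \<or> x = B r" | r where "r \<in> R" "x = A r" | r where "r \<in> R" "x = A (B r)"
      using x by blast
    then show ?thesis
    proof cases
      case 1
      then show ?thesis by (auto simp: B(2) intro: base)
    next
      case 2
      have "B (A r) \<in> W" by (rule BA; rule base) (use 2 in auto)
      then show ?thesis using 2 by simp
    next
      case 3
      have "B (A (B r)) \<in> W" by (rule BA; rule base) (use 3 in \<open>auto simp: B(2)\<close>)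
      then show ?thesis using 3 by simp
    qed
  qed
  show BW: "B x \<in> W" if "x \<in> W" for x
    using that unfolding W_def
    by (induction rule: span_induct_alt)
      (auto simp: L span_zero intro!: span_add span_scale gen[unfolded W_def])
  show "E x \<in> W" if "x \<in> W" for x
    unfolding Ev using that by (intro add scl AW BW wW)
  show "(c * c + c) *s x \<in> W" for x
  proof -
    \<comment> \<open>Adding \<open>z\<close> at \<open>x\<close>, its image under \<open>A\<close>,
      and \<open>z\<close> at \<open>A x\<close> cancels everything but the scalar term.\<close>
    have "(A (B x) + B (A x) + (c * c + c) *s x) + A (A (B x) + B (A x) + (c * c + c) *s x)
        + (A (B (A x)) + B (A (A x)) + (c * c + c) *s A x) \<in> W"
      by (intro add z AW)
    then show ?thesis by (simp add: L A(2) ac_simps)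
  qed
qed

text \<open>The stable subspace is finite-dimensional and contains the range of \<open>w\<close>, so
  the trace of \<open>w\<close> can be computed there, where it splits into three traces of
  idempotents and copies of \<open>c\<close>.\<close>

lemma finite_rank_trace:
  assumes A: "lin A" "\<And>x. A (A x) = A x" and B: "lin B" "\<And>x. B (B x) = B x"
    and E: "lin E" "\<And>x. E (E x) = E x"
    and c: "c \<in> {0, 1}" and fr: "finite_rank scale (\<lambda>x. A x + B x + E x - c *s x)"
  shows "fr_trace scale (\<lambda>x. A x + B x + E x - c *s x) \<in> {0, 1}"
proof -
  define w where "w x = A x + B x + E x - c *s x" for x
  have w: "lin w"
    by (intro linI) (simp_all add: w_def lin_simps[OF A(1)] lin_simps[OF B(1)] lin_simps[OF E(1)] algebra_simps)
  obtain R0 where R0: "finite R0" "span R0 = range w" using fr unfolding finite_rank_def w_def by blast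
  obtain R where R: "R \<subseteq> R0" "independent R" "R0 \<subseteq> span R" using maximal_independent_subset by blast
  have fR: "finite R" using R(1) R0(1) finite_subset by blast
  have "span R = span R0" unfolding span_eq using R span_superset by (meson subset_trans)
  then have Rw: "span R = range w" using R0(2) by simp
  let ?F = "R \<union> A ` R \<union> B ` R \<union> (\<lambda>x. A (B x)) ` R"
  note inv = sum_of_idempotents_invariant_subspace[OF A B E w_def Rw]
  \<comment> \<open>\<open>Q\<close> extends a basis of the range of \<open>w\<close>. The vectors
    outside \<open>R\<close> add nothing to the trace, since \<open>w\<close> maps into the span of
    \<open>R\<close>.\<close>
  obtain Q where Q: "R \<subseteq> Q" "Q \<subseteq> ?F" "independent Q" "?F \<subseteq> span Q"
    using maximal_independent_subset_extend[of R ?F] R(2) by blast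
  have fQ: "finite Q" by (rule finite_subset[OF Q(2)]) (simp add: fR)
  have QF: "span Q = span ?F" unfolding span_eq using Q(2,4) span_superset by (meson subset_trans)
  have in_Q: "x \<in> span ?F" "x \<in> span Q" if "x \<in> Q" for x
    using that unfolding QF[symmetric] by (auto intro: span_base)
  have "fr_trace scale w = (\<Sum>b\<in>R. representation R (w b) b)"
    by (rule fr_trace_eq[OF w R(2) fR Rw])
  also have "\<dots> = (\<Sum>b\<in>R. representation Q (w b) b)"
    using representation_extend[OF Q(3) _ Q(1)] Rw by simp
  also have "\<dots> = (\<Sum>b\<in>Q. representation Q (w b) b)"
  proof (rule sum.mono_neutral_left[OF fQ Q(1)], rule ballI)
    fix b assume "b \<in> Q - R"
    then show "representation Q (w b) b = 0"
      using representation_extend[OF Q(3) _ Q(1), of "w b"] Rw representation_ne_zero[of R "w b" b] by auto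
  qed
  also have "\<dots> = (\<Sum>b\<in>Q. representation Q (A b) b) + (\<Sum>b\<in>Q. representation Q (B b) b)
      + (\<Sum>b\<in>Q. representation Q (E b) b) + (\<Sum>b\<in>Q. c)"
  proof -
    have "representation Q (w b) b = representation Q (A b) b + representation Q (B b) b
        + representation Q (E b) b + c" if b: "b \<in> Q" for b
    proof -
      have "A b \<in> span Q" "B b \<in> span Q" "E b \<in> span Q" "c *s b \<in> span Q"
        using inv(1-3)[OF in_Q(1)[OF b]] in_Q(2)[OF b] by (simp_all add: QF span_scale)
      then show ?thesis
        using b by (simp add: w_def vec_diff representation_add[OF Q(3)] representation_scale[OF Q(3)]
            representation_basis[OF Q(3)] span_add in_Q)
    qed
    then show ?thesis by (simp add: sum.distrib)
  qed
  also have "\<dots> \<in> {0, 1}"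
    using inv(1-3) in_Q c QF
    by (intro add_01 idempotent_trace A B E fQ Q(3) sum_01) auto
  finally show ?thesis unfolding w_def .
qed

text \<open>For such \<open>c\<close> the scalar \<open>c * c + c\<close> is invertible, so the
  stable subspace is the whole space. But it is spanned by four copies of a set smaller than a
  basis.\<close>

lemma no_dominant_eigenvalue:
  assumes inf: "infinite_dimensional scale"
    and A: "lin A" "\<And>x. A (A x) = A x" and B: "lin B" "\<And>x. B (B x) = B x"
    and E: "lin E" "\<And>x. E (E x) = E x" and c: "c \<notin> {0, 1}"
  shows "\<not> dominant_eigenvalue scale (\<lambda>x. A x + B x + E x) c"
proof
  assume dom: "dominant_eigenvalue scale (\<lambda>x. A x + B x + E x) c"
  define w where "w x = A x + B x + E x - c *s x" for x
  have w: "lin w"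
    by (intro linI) (simp_all add: w_def lin_simps[OF A(1)] lin_simps[OF B(1)] lin_simps[OF E(1)] algebra_simps)
  define R where "R = (SOME B. is_basis_of scale B (range w))"
  define D where "D = (SOME B. is_basis_of scale B (UNIV :: 'v set))"
  have R: "span R = range w" using range_basis[OF w R_def] by blast
  have D: "independent D" "span D = UNIV" using UNIV_basis[OF D_def] .
  have iD: "infinite D" using inf D(2) unfolding infinite_dimensional_def by blast
  have RD: "R \<prec> D"
    using dom unfolding dominant_eigenvalue_def rk_def dimc_def w_def[symmetric] R_def D_def .
  have im: "f ` R \<prec> D" for f :: "'v \<Rightarrow> 'v" using card_of_image RD by (rule ordLeq_ordLess_trans)
  let ?F = "R \<union> A ` R \<union> B ` R \<union> (\<lambda>x. A (B x)) ` R"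
  have F: "?F \<prec> D" by (intro card_of_Un_ordLess_infinite[OF iD] RD im)
  have "c * c + c \<noteq> 0"
  proof
    assume "c * c + c = 0"
    then have "c * (c + 1) = 0" by (simp add: algebra_simps)
    then have "c = 0 \<or> c = 1" using char2 by (metis add_right_cancel mult_eq_0_iff)
    then show False using c by simp
  qed
  then have "x \<in> span ?F" for x
    using span_scale[OF sum_of_idempotents_invariant_subspace(4)[OF A B E w_def R], of "inverse (c * c + c)" x] by simp
  then have "D \<lesssim> ?F" by (intro independent_card_le[OF D(1)]) blast
  then show False using F by (simp add: card_less_iff)
qed

end

theorem theorem6:
  fixes scale :: "'f::field \<Rightarrow> 'v::ab_group_add \<Rightarrow> 'v" and u :: "'v \<Rightarrow> 'v"
  assumes "vector_space scale"
    and "(1::'f) + 1 = 0"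
    and "infinite_dimensional scale"
    and "Vector_Spaces.linear scale scale u"
  shows "(\<exists>e1 e2 e3. idempotent_endo scale e1 \<and> idempotent_endo scale e2 \<and> idempotent_endo scale e3
            \<and> u = (\<lambda>x. e1 x + e2 x + e3 x))
     \<longleftrightarrow> \<not> (\<exists>c. c \<notin> {0, 1} \<and> dominant_eigenvalue scale u c)
       \<and> \<not> (\<exists>c \<in> {0, 1}. finite_rank scale (\<lambda>x. u x - scale c x)
                \<and> fr_trace scale (\<lambda>x. u x - scale c x) \<notin> {0, 1})"
proof -
  interpret char2_space scale
    using assms(1,2) by (simp add: char2_space_def char2_space_axioms_def)
  show ?thesis
    unfolding three_idempotents_def[symmetric]
  proof (intro iffI conjI notI)
    assume "three_idempotents u"
    then obtain e1 e2 e3 where e: "idempotent_endo scale e1" "idempotent_endo scale e2" "idempotent_endo scale e3"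
      and u: "u = (\<lambda>x. e1 x + e2 x + e3 x)"
      unfolding three_idempotents_def by blast
    have l: "lin e1" "lin e2" "lin e3" using e by (simp_all add: idempotent_endo_def)
    have i: "e1 (e1 x) = e1 x" "e2 (e2 x) = e2 x" "e3 (e3 x) = e3 x" for x
      using e by (simp_all add: idempotent_endo_def fun_eq_iff)
    show False if "\<exists>c. c \<notin> {0, 1} \<and> dominant_eigenvalue scale u c"
      using that no_dominant_eigenvalue[OF assms(3) l(1) i(1) l(2) i(2) l(3) i(3)] unfolding u by blast
    show False if "\<exists>c\<in>{0, 1}. finite_rank scale (\<lambda>x. u x - scale c x)
        \<and> fr_trace scale (\<lambda>x. u x - scale c x) \<notin> {0, 1}"
      using that finite_rank_trace[OF l(1) i(1) l(2) i(2) l(3) i(3)] unfolding u by blast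
  next
    assume "\<not> (\<exists>c. c \<notin> {0, 1} \<and> dominant_eigenvalue scale u c)
      \<and> \<not> (\<exists>c\<in>{0, 1}. finite_rank scale (\<lambda>x. u x - scale c x)
        \<and> fr_trace scale (\<lambda>x. u x - scale c x) \<notin> {0, 1})"
    then show "three_idempotents u"
      by (intro three_idempotents_if[OF assms(4,3)]) blast+
  qed
qed

end
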